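(* The family of all $\Sigma^0_1$ classes of measure less than one has a Friedberg numbering; equivalently, the family of all $\Pi^0_1$ classes of positive measure has a Friedberg numbering.
   Context: Measure is the fair-coin (Cantor–Lebesgue) measure on $2^\omega$. A $\Pi^0_1$ class is the set $[T]=\{X\in 2^\omega : \forall n\; X\upharpoonright n\in T\}$ of infinite paths through a computable tree $T\subseteq 2^{<\omega}$ (a set of strings closed under prefixes); a $\Sigma^0_1$ class is the complement in $2^\omega$ of a $\Pi^0_1$ class. An effective numbering of a family $\mathcal{F}$ of $\Sigma^0_1$ (respectively $\Pi^0_1$) classes is a surjection $\psi:\omega\to\mathcal{F}$ such that $\{(X,e) : X\in\psi(e)\}$ is a $\Sigma^0_1$ (respectively $\Pi^0_1$) subset of $2^\omega\times\omega$. If in addition $\psi$ is injective, it is called a Friedberg numbering of $\mathcal{F}$. *)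

theory Defs
  imports "HOL-Probability.Probability" "HOL-Library.Nat_Bijection" "HOL-Library.Sublist"
begin

text \<open>
  The total computable functions on \<open>nat\<close>, presented as unary functions with Cantor pairing in
  place of higher arities. Minimization is only applied to regular functions, so every member
  of the class is total.
\<close>

inductive computable :: "(nat \<Rightarrow> nat) \<Rightarrow> bool" where
  zero: "computable (\<lambda>_. 0)"
| succ: "computable Suc"
| left: "computable (\<lambda>x. fst (prod_decode x))"
| right: "computable (\<lambda>x. snd (prod_decode x))"
| pair: "computable f \<Longrightarrow> computable g \<Longrightarrow> computable (\<lambda>x. prod_encode (f x, g x))"
| comp: "computable f \<Longrightarrow> computable g \<Longrightarrow> computable (\<lambda>x. f (g x))"
| prec: "computable f \<Longrightarrow> computable g \<Longrightarrow>
    computable (\<lambda>x. case prod_decode x of (a, n) \<Rightarrow>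
      rec_nat (f a) (\<lambda>m r. g (prod_encode (a, prod_encode (m, r)))) n)"
| mu: "computable f \<Longrightarrow> (\<forall>x. \<exists>y. f (prod_encode (x, y)) = 0) \<Longrightarrow>
    computable (\<lambda>x. LEAST y. f (prod_encode (x, y)) = 0)"

definition computable_set :: "nat set \<Rightarrow> bool" where
  "computable_set A \<longleftrightarrow> computable (\<lambda>n. of_bool (n \<in> A))"

type_synonym cantor = "nat \<Rightarrow> bool"

definition restr :: "cantor \<Rightarrow> nat \<Rightarrow> bool list" where
  "restr X n = map X [0..<n]"

definition string_code :: "bool list \<Rightarrow> nat" where
  "string_code \<sigma> = list_encode (map of_bool \<sigma>)"

definition computable_tree :: "bool list set \<Rightarrow> bool" where
  "computable_tree T \<longleftrightarrow>
     (\<forall>\<sigma> \<tau>. prefix \<sigma> \<tau> \<longrightarrow> \<tau> \<in> T \<longrightarrow> \<sigma> \<in> T) \<and> computable_set (string_code ` T)"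

definition paths :: "bool list set \<Rightarrow> cantor set" where
  "paths T = {X. \<forall>n. restr X n \<in> T}"

definition Pi01_class :: "cantor set \<Rightarrow> bool" where
  "Pi01_class P \<longleftrightarrow> (\<exists>T. computable_tree T \<and> P = paths T)"

definition Sigma01_class :: "cantor set \<Rightarrow> bool" where
  "Sigma01_class U \<longleftrightarrow> Pi01_class (- U)"

text \<open>
  Arithmetical pointclasses on \<open>2\<^sup>\<omega> \<times> \<omega>\<close>: a \<open>\<Sigma>\<close> set at the first level is
  \<open>{(X, e). \<exists>n. R (X restricted to n) e}\<close> with a computable matrix \<open>R\<close>, and dually for \<open>\<Pi>\<close>.
  A separate argument \<open>n\<close> of \<open>R\<close> is redundant, being the length of the string.
\<close>

definition computable_matrix :: "(bool list \<times> nat) set \<Rightarrow> bool" where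
  "computable_matrix R \<longleftrightarrow>
     computable_set ((\<lambda>(\<sigma>, e). prod_encode (string_code \<sigma>, e)) ` R)"

definition Sigma01_rel :: "(cantor \<times> nat) set \<Rightarrow> bool" where
  "Sigma01_rel S \<longleftrightarrow>
     (\<exists>R. computable_matrix R \<and> S = {(X, e). \<exists>n. (restr X n, e) \<in> R})"

definition Pi01_rel :: "(cantor \<times> nat) set \<Rightarrow> bool" where
  "Pi01_rel S \<longleftrightarrow>
     (\<exists>R. computable_matrix R \<and> S = {(X, e). \<forall>n. (restr X n, e) \<in> R})"

definition Sigma01_numbering :: "(nat \<Rightarrow> cantor set) \<Rightarrow> cantor set set \<Rightarrow> bool" where
  "Sigma01_numbering \<psi> F \<longleftrightarrow> range \<psi> = F \<and> Sigma01_rel {(X, e). X \<in> \<psi> e}"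

definition Pi01_numbering :: "(nat \<Rightarrow> cantor set) \<Rightarrow> cantor set set \<Rightarrow> bool" where
  "Pi01_numbering \<psi> F \<longleftrightarrow> range \<psi> = F \<and> Pi01_rel {(X, e). X \<in> \<psi> e}"

definition Sigma01_Friedberg_numbering :: "(nat \<Rightarrow> cantor set) \<Rightarrow> cantor set set \<Rightarrow> bool" where
  "Sigma01_Friedberg_numbering \<psi> F \<longleftrightarrow> Sigma01_numbering \<psi> F \<and> inj \<psi>"

definition Pi01_Friedberg_numbering :: "(nat \<Rightarrow> cantor set) \<Rightarrow> cantor set set \<Rightarrow> bool" where
  "Pi01_Friedberg_numbering \<psi> F \<longleftrightarrow> Pi01_numbering \<psi> F \<and> inj \<psi>"

definition coin_measure :: "cantor measure" where
  "coin_measure = PiM UNIV (\<lambda>_. measure_pmf (bernoulli_pmf (1/2)))"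

end

theory Submission
  imports Defs
begin

text \<open>
  The proof follows Kummer's method. Call the complement of a cylinder \<open>[\<sigma>]\<close> with \<open>\<sigma>\<close>
  nonempty a co-cylinder. Co-cylinders are numbered injectively by their strings, and every clopen
  set other than the whole space is contained in infinitely many of them. The other \<open>\<Sigma>\<^sup>0\<^sub>1\<close> classes of measure less
  than one have an effective numbering: enumerate an arbitrary \<open>\<Sigma>\<^sup>0\<^sub>1\<close> class, but accept a clopen
  stage only if its measure is at most \<open>1 - 2\<^sup>-\<^sup>k\<close> and it is not a co-cylinder. Nothing is lost, since a
  class whose stages are eventually all co-cylinders is a co-cylinder itself or has measure one.

  To remove repetitions, a follower of \<open>j\<close> is created whenever the evidence that the \<open>j\<close>-th class
  equals an earlier one grows, which by compactness happens finitely often iff \<open>j\<close> is the least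
  index of its class. A follower copies the \<open>j\<close>-th class until the next such event and then turns
  into a co-cylinder that contains the clopen set enumerated so far and is not used by any other
  follower. Hence exactly the last follower of each least index survives, and the unused
  co-cylinders receive indices of their own.
\<close>

section \<open>Closure properties of the computable functions\<close>

definition pfst :: "nat \<Rightarrow> nat" where "pfst z = fst (prod_decode z)"
definition psnd :: "nat \<Rightarrow> nat" where "psnd z = snd (prod_decode z)"

abbreviation pr :: "nat \<Rightarrow> nat \<Rightarrow> nat" where "pr a b \<equiv> prod_encode (a, b)"

lemma pfst_pr [simp]: "pfst (pr a b) = a" and psnd_pr [simp]: "psnd (pr a b) = b"
  by (simp_all add: pfst_def psnd_def)

lemma pr_collapse [simp]: "pr (pfst z) (psnd z) = z"
  by (simp add: pfst_def psnd_def)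

definition decidable :: "(nat \<Rightarrow> bool) \<Rightarrow> bool" where
  "decidable P \<longleftrightarrow> computable (\<lambda>x. of_bool (P x))"

named_theorems comp_intros

lemma computable_app1: "computable f \<Longrightarrow> computable a \<Longrightarrow> computable (\<lambda>x. f (a x))"
  by (rule computable.comp)

lemma decidable_app1: "decidable P \<Longrightarrow> computable a \<Longrightarrow> decidable (\<lambda>x. P (a x))"
  unfolding decidable_def by (rule computable.comp)

lemma computable_pair [comp_intros]:
  "computable a \<Longrightarrow> computable b \<Longrightarrow> computable (\<lambda>x. pr (a x) (b x))"
  by (rule computable.pair)

text \<open>\<open>computable\<close> speaks of unary functions only, so a function of several
  arguments is presented through the projections of a pair; the substitution rules return it to
  curried form.\<close>

lemma computable_app2:
  "computable (\<lambda>z. F (pfst z) (psnd z)) \<Longrightarrow> computable a \<Longrightarrow> computable b \<Longrightarrow>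
    computable (\<lambda>x. F (a x) (b x))"
  using computable_app1[of "\<lambda>z. F (pfst z) (psnd z)" "\<lambda>x. pr (a x) (b x)"]
  by (simp add: computable_pair)

lemma decidable_app2:
  "decidable (\<lambda>z. P (pfst z) (psnd z)) \<Longrightarrow> computable a \<Longrightarrow> computable b \<Longrightarrow>
    decidable (\<lambda>x. P (a x) (b x))"
  unfolding decidable_def by (rule computable_app2)

lemma decidable_app3:
  "decidable (\<lambda>z. P (pfst z) (pfst (psnd z)) (psnd (psnd z))) \<Longrightarrow>
    computable a \<Longrightarrow> computable b \<Longrightarrow> computable c \<Longrightarrow>
    decidable (\<lambda>x. P (a x) (b x) (c x))"
  using decidable_app1[of "\<lambda>z. P (pfst z) (pfst (psnd z)) (psnd (psnd z))" "\<lambda>x. pr (a x) (pr (b x) (c x))"]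
  by (simp add: computable_pair)

lemma decidable_app4:
  "decidable (\<lambda>z. P (pfst z) (pfst (psnd z)) (pfst (psnd (psnd z))) (psnd (psnd (psnd z)))) \<Longrightarrow>
    computable a \<Longrightarrow> computable b \<Longrightarrow> computable c \<Longrightarrow> computable d \<Longrightarrow>
    decidable (\<lambda>x. P (a x) (b x) (c x) (d x))"
  using decidable_app1[of "\<lambda>z. P (pfst z) (pfst (psnd z)) (pfst (psnd (psnd z))) (psnd (psnd (psnd z)))"
      "\<lambda>x. pr (a x) (pr (b x) (pr (c x) (d x)))"]
  by (simp add: computable_pair)

lemma computable_pfst [comp_intros]: "computable a \<Longrightarrow> computable (\<lambda>x. pfst (a x))"
  unfolding pfst_def by (rule computable_app1[OF computable.left])

lemma computable_psnd [comp_intros]: "computable a \<Longrightarrow> computable (\<lambda>x. psnd (a x))"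
  unfolding psnd_def by (rule computable_app1[OF computable.right])

lemma computable_id [comp_intros]: "computable (\<lambda>x. x)"
  using computable.pair[OF computable.left computable.right] by simp

lemma computable_Suc [comp_intros]: "computable a \<Longrightarrow> computable (\<lambda>x. Suc (a x))"
  by (rule computable_app1[OF computable.succ])

lemma computable_const [comp_intros]: "computable (\<lambda>x. c)"
  by (induction c) (auto intro: computable.zero computable_Suc)

section \<open>Arithmetic from primitive recursion\<close>

lemma computable_rec:
  assumes "computable f" "computable (\<lambda>z. g (pfst z) (pfst (psnd z)) (psnd (psnd z)))" "computable n"
  shows "computable (\<lambda>x. rec_nat (f x) (g x) (n x))"
proof -
  have "computable (\<lambda>z. rec_nat (f (pfst z)) (g (pfst z)) (psnd z))"
    using computable.prec[OF assms(1,2)] by (simp add: pfst_def psnd_def case_prod_beta)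
  from computable_app2[OF this computable_id assms(3)] show ?thesis .
qed

lemma computable_add [comp_intros]:
  assumes "computable a" "computable b" shows "computable (\<lambda>x. a x + b x)"
proof -
  have "rec_nat m (\<lambda>_ r. Suc r) n = m + n" for m n :: nat by (induction n) auto
  moreover have "computable (\<lambda>x. rec_nat (a x) (\<lambda>_ r. Suc r) (b x))"
    by (intro computable_rec comp_intros assms)
  ultimately show ?thesis by simp
qed

lemma computable_mult [comp_intros]:
  assumes "computable a" "computable b" shows "computable (\<lambda>x. a x * b x)"
proof -
  have "rec_nat 0 (\<lambda>_ r. r + m) n = m * n" for m n :: nat by (induction n) auto
  moreover have "computable (\<lambda>x. rec_nat 0 (\<lambda>_ r. r + a x) (b x))"
    by (intro computable_rec comp_intros assms computable_app1[OF assms(1)])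
  ultimately show ?thesis by simp
qed

lemma computable_power [comp_intros]:
  assumes "computable a" "computable b" shows "computable (\<lambda>x. a x ^ b x)"
proof -
  have "rec_nat 1 (\<lambda>_ r. r * m) n = m ^ n" for m n :: nat by (induction n) auto
  moreover have "computable (\<lambda>x. rec_nat 1 (\<lambda>_ r. r * a x) (b x))"
    by (intro computable_rec comp_intros assms computable_app1[OF assms(1)])
  ultimately show ?thesis by simp
qed

lemma computable_diff [comp_intros]:
  assumes "computable a" "computable b" shows "computable (\<lambda>x. a x - b x)"
proof -
  \<comment> \<open>The predecessor is a recursion that discards the previous value and returns the
    counter; \<open>2\<close> iterates it.\<close>
  have 1: "rec_nat 0 (\<lambda>k _. k) n = n - 1" for n :: nat by (induction n) auto
  have 2: "rec_nat m (\<lambda>_ r. rec_nat 0 (\<lambda>k _. k) r) n = m - n" for m n :: nat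
    by (induction n) (auto simp: 1)
  have "computable (\<lambda>x. rec_nat (a x) (\<lambda>_ r. rec_nat 0 (\<lambda>k _. k) r) (b x))"
    by (intro computable_rec comp_intros assms)
  then show ?thesis unfolding 2 .
qed

section \<open>Decidable predicates and bounded quantifiers\<close>

lemma decidable_less [comp_intros]:
  assumes "computable a" "computable b" shows "decidable (\<lambda>x. a x < b x)"
proof -
  have "computable (\<lambda>x. 1 - (1 - (b x - a x)))"
    by (intro comp_intros assms)
  moreover have "(1 - (1 - (n - m))) = of_bool (m < n)" for m n :: nat by auto
  ultimately show ?thesis by (simp add: decidable_def)
qed

lemma decidable_not [comp_intros]:
  assumes "decidable P" shows "decidable (\<lambda>x. \<not> P x)"
proof -
  have "computable (\<lambda>x. 1 - of_bool (P x))"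
    using assms unfolding decidable_def by (intro comp_intros)
  moreover have "1 - of_bool p = (of_bool (\<not> p) :: nat)" for p by auto
  ultimately show ?thesis by (simp add: decidable_def)
qed

lemma decidable_conj [comp_intros]:
  assumes "decidable P" "decidable Q" shows "decidable (\<lambda>x. P x \<and> Q x)"
proof -
  have "computable (\<lambda>x. of_bool (P x) * of_bool (Q x))"
    using assms unfolding decidable_def by (intro comp_intros)
  then show ?thesis by (simp add: decidable_def of_bool_conj)
qed

lemma decidable_disj [comp_intros]:
  assumes "decidable P" "decidable Q" shows "decidable (\<lambda>x. P x \<or> Q x)"
proof -
  have "decidable (\<lambda>x. \<not> (\<not> P x \<and> \<not> Q x))" by (intro comp_intros assms)
  then show ?thesis by simp
qed

lemma decidable_imp [comp_intros]:
  assumes "decidable P" "decidable Q" shows "decidable (\<lambda>x. P x \<longrightarrow> Q x)"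
proof -
  have "decidable (\<lambda>x. \<not> P x \<or> Q x)" by (intro comp_intros assms)
  then show ?thesis by simp
qed

lemma decidable_le [comp_intros]:
  assumes "computable a" "computable b" shows "decidable (\<lambda>x. a x \<le> b x)"
  using decidable_not[OF decidable_less[OF assms(2,1)]] by (simp add: not_less)

lemma decidable_eq [comp_intros]:
  assumes "computable a" "computable b" shows "decidable (\<lambda>x. a x = b x)"
proof -
  have "decidable (\<lambda>x. a x \<le> b x \<and> b x \<le> a x)" by (intro comp_intros assms)
  then show ?thesis by (simp add: order_eq_iff)
qed

lemma computable_sum:
  assumes "computable (\<lambda>z. g (pfst z) (psnd z))" "computable n"
  shows "computable (\<lambda>x. \<Sum>w<n x. g x w)"
proof -
  have "rec_nat 0 (\<lambda>w r. r + h w) m = (\<Sum>w<m. h w)" for h :: "nat \<Rightarrow> nat" and m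
    by (induction m) auto
  moreover have "computable (\<lambda>x. rec_nat 0 (\<lambda>w r. r + g x w) (n x))"
    by (intro computable_rec comp_intros assms computable_app2[OF assms(1)])
  ultimately show ?thesis by simp
qed

lemma decidable_Ex_less [comp_intros]:
  assumes "decidable (\<lambda>z. P (pfst z) (psnd z))" "computable n"
  shows "decidable (\<lambda>x. \<exists>w<n x. P x w)"
proof -
  have "decidable (\<lambda>x. 0 < (\<Sum>w<n x. of_bool (P x w) :: nat))"
    using assms by (intro comp_intros computable_sum) (auto simp: decidable_def)
  moreover have "0 < (\<Sum>w<m. of_bool (p w) :: nat) \<longleftrightarrow> (\<exists>w<m. p w)" for p and m :: nat
    by (induction m) (auto simp: less_Suc_eq)
  ultimately show ?thesis by (simp only:)
qed

lemma decidable_All_less [comp_intros]: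
  assumes "decidable (\<lambda>z. P (pfst z) (psnd z))" "computable n"
  shows "decidable (\<lambda>x. \<forall>w<n x. P x w)"
proof -
  have "decidable (\<lambda>x. \<not> (\<exists>w<n x. \<not> P x w))" by (intro comp_intros assms)
  then show ?thesis by simp
qed

lemma decidable_Ex_le [comp_intros]:
  assumes "decidable (\<lambda>z. P (pfst z) (psnd z))" "computable n"
  shows "decidable (\<lambda>x. \<exists>w\<le>n x. P x w)"
  using decidable_Ex_less[OF assms(1) computable_Suc[OF assms(2)]] by (simp add: less_Suc_eq_le)

lemma decidable_All_le [comp_intros]:
  assumes "decidable (\<lambda>z. P (pfst z) (psnd z))" "computable n"
  shows "decidable (\<lambda>x. \<forall>w\<le>n x. P x w)"
  using decidable_All_less[OF assms(1) computable_Suc[OF assms(2)]] by (simp add: less_Suc_eq_le)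

section \<open>Total minimization\<close>

lemma computable_Least:
  assumes "decidable (\<lambda>z. P (pfst z) (psnd z))" "\<And>x. \<exists>y. P x y"
  shows "computable (\<lambda>x. LEAST y. P x y)"
proof -
  have "computable (\<lambda>z. of_bool (\<not> P (pfst z) (psnd z)))"
    using decidable_not[OF assms(1)] by (simp add: decidable_def)
  from computable.mu[OF this] assms(2) show ?thesis by simp
qed

lemma computable_div [comp_intros]:
  assumes "computable a" "computable b" shows "computable (\<lambda>x. a x div b x)"
proof -
  have ex: "m < n * Suc (m div n)" if "n \<noteq> 0" for m n :: nat
    using that by (metis dividend_less_times_div mult_Suc_right not_gr0)
  \<comment> \<open>The disjunct \<open>n = 0\<close> keeps the search total and yields
    \<open>m div 0 = 0\<close>.\<close>
  have "(LEAST q. n = 0 \<or> m < n * Suc q) = m div n" for m n :: nat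
  proof (cases "n = 0")
    case False
    show ?thesis
    proof (rule Least_equality)
      fix q assume "n = 0 \<or> m < n * Suc q"
      then show "m div n \<le> q"
        using False by (metis less_mult_imp_div_less less_Suc_eq_le mult.commute)
    qed (use ex False in auto)
  qed (auto intro: Least_equality)
  moreover have "computable (\<lambda>x. LEAST q. b x = 0 \<or> a x < b x * Suc q)"
    using ex by (intro computable_Least comp_intros computable_app1[OF assms(1)]
      computable_app1[OF assms(2)]) blast
  ultimately show ?thesis by simp
qed

lemma computable_mod [comp_intros]:
  assumes "computable a" "computable b" shows "computable (\<lambda>x. a x mod b x)"
proof -
  have "computable (\<lambda>x. a x - b x * (a x div b x))" by (intro comp_intros assms)
  then show ?thesis by (simp add: minus_mult_div_eq_mod)
qed

lemma decidable_set_decode [comp_intros]: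
  assumes "computable a" "computable b" shows "decidable (\<lambda>x. a x \<in> set_decode (b x))"
proof -
  have "decidable (\<lambda>x. b x div 2 ^ a x mod 2 = 1)" by (intro comp_intros assms)
  then show ?thesis by (simp add: set_decode_def odd_iff_mod_2_eq_one)
qed

lemma computable_if [comp_intros]:
  assumes "decidable P" "computable a" "computable b"
  shows "computable (\<lambda>x. if P x then a x else b x)"
proof -
  have "computable (\<lambda>x. of_bool (P x) * a x + (1 - of_bool (P x)) * b x)"
    using assms unfolding decidable_def by (intro comp_intros)
  moreover have "of_bool p * m + (1 - of_bool p) * n = (if p then m else n)" for p and m n :: nat
    by auto
  ultimately show ?thesis by simp
qed

text \<open>Infinity of \<open>S\<close> makes the search for the next larger element total, and
  iterating it lists \<open>S\<close> in increasing order.\<close>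

lemma computable_enumerate:
  assumes "decidable (\<lambda>x. x \<in> S)" "infinite S"
  shows "computable (enumerate S)"
proof -
  have step: "computable (\<lambda>r. LEAST s. s \<in> S \<and> r < s)"
    using assms(2)
    by (intro computable_Least comp_intros decidable_app1[OF assms(1)])
      (meson infinite_nat_iff_unbounded)
  have *: "computable (\<lambda>n. rec_nat (LEAST s. s \<in> S) (\<lambda>_ r. LEAST s. s \<in> S \<and> r < s) n)"
    by (intro computable_rec comp_intros computable_app1[OF step])
  have "rec_nat (LEAST s. s \<in> S) (\<lambda>_ r. LEAST s. s \<in> S \<and> r < s) n = enumerate S n" for n
    by (induction n) (simp_all add: enumerate_0 enumerate_Suc'' assms(2))
  with * show ?thesis by simp
qed

section \<open>A universal enumeration\<close>

text \<open>A relation rather than a decoding function, since a number that describes a minimization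
  that is not regular codes nothing.\<close>

inductive codes :: "nat \<Rightarrow> (nat \<Rightarrow> nat) \<Rightarrow> bool" where
  "codes (pr 0 d) (\<lambda>_. 0)"
| "codes (pr 1 d) Suc"
| "codes (pr 2 d) pfst"
| "codes (pr 3 d) psnd"
| "codes a f \<Longrightarrow> codes b g \<Longrightarrow> codes (pr 4 (pr a b)) (\<lambda>x. pr (f x) (g x))"
| "codes a f \<Longrightarrow> codes b g \<Longrightarrow> codes (pr 5 (pr a b)) (\<lambda>x. f (g x))"
| "codes a f \<Longrightarrow> codes b g \<Longrightarrow> codes (pr 6 (pr a b))
    (\<lambda>x. rec_nat (f (pfst x)) (\<lambda>m r. g (pr (pfst x) (pr m r))) (psnd x))"
| "codes a f \<Longrightarrow> (\<forall>x. \<exists>y. f (pr x y) = 0) \<Longrightarrow>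
    codes (pr 7 (pr a b)) (\<lambda>x. LEAST y. f (pr x y) = 0)"

lemma codes_exists: "computable f \<Longrightarrow> \<exists>c. codes c f"
proof (induction rule: computable.induct)
  case left
  then show ?case using codes.intros(3) by (auto simp: pfst_def[abs_def])
next
  case right
  then show ?case using codes.intros(4) by (auto simp: psnd_def[abs_def])
next
  case (prec f g)
  then obtain a b where "codes a f" "codes b g" by blast
  from codes.intros(7)[OF this] show ?case by (auto simp: pfst_def psnd_def case_prod_beta)
qed (blast intro: codes.intros)+

text \<open>
  A computation is certified by a finite set of facts, each justified by facts in the same set.
  No order on the facts is needed: apart from primitive recursion, where the recursion argument decreases, a justification only refers to codes of proper subterms.
\<close>

definition fact :: "nat \<Rightarrow> nat \<Rightarrow> nat \<Rightarrow> nat" where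
  "fact c x y = pr c (pr x y)"

definition justified :: "nat set \<Rightarrow> nat \<Rightarrow> nat \<Rightarrow> nat \<Rightarrow> bool" where
  "justified D c x y \<longleftrightarrow>
     pfst c = 0 \<and> y = 0 \<or>
     pfst c = 1 \<and> y = Suc x \<or>
     pfst c = 2 \<and> y = pfst x \<or>
     pfst c = 3 \<and> y = psnd x \<or>
     pfst c = 4 \<and> fact (pfst (psnd c)) x (pfst y) \<in> D \<and> fact (psnd (psnd c)) x (psnd y) \<in> D \<or>
     pfst c = 5 \<and> (\<exists>z. fact (psnd (psnd c)) x z \<in> D \<and> fact (pfst (psnd c)) z y \<in> D) \<or>
     pfst c = 6 \<and> psnd x = 0 \<and> fact (pfst (psnd c)) (pfst x) y \<in> D \<or>
     pfst c = 6 \<and> psnd x \<noteq> 0 \<and> (\<exists>r. fact c (pr (pfst x) (psnd x - 1)) r \<in> D \<and>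
       fact (psnd (psnd c)) (pr (pfst x) (pr (psnd x - 1) r)) y \<in> D) \<or>
     pfst c = 7 \<and> fact (pfst (psnd c)) (pr x y) 0 \<in> D \<and>
       (\<forall>z<y. \<exists>r. fact (pfst (psnd c)) (pr x z) r \<in> D \<and> r \<noteq> 0)"

definition certificate :: "nat set \<Rightarrow> bool" where
  "certificate D \<longleftrightarrow> (\<forall>p\<in>D. justified D (pfst p) (pfst (psnd p)) (psnd (psnd p)))"

lemma justified_mono: "justified D c x y \<Longrightarrow> D \<subseteq> D' \<Longrightarrow> justified D' c x y"
  unfolding justified_def by (elim disjE) (auto; blast)+

lemma certificateD: "certificate D \<Longrightarrow> fact c x y \<in> D \<Longrightarrow> justified D c x y"
  by (fastforce simp: certificate_def fact_def)

lemma certificate_Union: "(\<And>D. D \<in> \<D> \<Longrightarrow> certificate D) \<Longrightarrow> certificate (\<Union>\<D>)"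
  unfolding certificate_def by (meson Union_iff Union_upper justified_mono)

lemma certificate_Un: "certificate D \<Longrightarrow> certificate E \<Longrightarrow> certificate (D \<union> E)"
  using certificate_Union[of "{D, E}"] by auto

lemma certificate_insert:
  "certificate D \<Longrightarrow> justified D c x y \<Longrightarrow> certificate (insert (fact c x y) D)"
  unfolding certificate_def by (auto simp: fact_def intro: justified_mono)

lemma justified_simps:
  "justified D (pr 0 d) x y \<longleftrightarrow> y = 0"
  "justified D (pr 1 d) x y \<longleftrightarrow> y = Suc x"
  "justified D (pr 2 d) x y \<longleftrightarrow> y = pfst x"
  "justified D (pr 3 d) x y \<longleftrightarrow> y = psnd x"
  "justified D (pr 4 (pr a b)) x y \<longleftrightarrow> fact a x (pfst y) \<in> D \<and> fact b x (psnd y) \<in> D"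
  "justified D (pr 5 (pr a b)) x y \<longleftrightarrow> (\<exists>z. fact b x z \<in> D \<and> fact a z y \<in> D)"
  "justified D (pr 6 (pr a b)) (pr u 0) y \<longleftrightarrow> fact a u y \<in> D"
  "justified D (pr 6 (pr a b)) (pr u (Suc n)) y \<longleftrightarrow>
    (\<exists>r. fact (pr 6 (pr a b)) (pr u n) r \<in> D \<and> fact b (pr u (pr n r)) y \<in> D)"
  "justified D (pr 7 (pr a b)) x y \<longleftrightarrow> fact a (pr x y) 0 \<in> D \<and>
    (\<forall>z<y. \<exists>r. fact a (pr x z) r \<in> D \<and> r \<noteq> 0)"
  by (simp_all add: justified_def)

lemma certificate_sound:
  assumes "certificate D" "codes c f" "fact c x y \<in> D"
  shows "y = f x"
  using assms(2,3)
proof (induction arbitrary: x y)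
  case (5 a f b g)
  from certificateD[OF assms(1) "5.prems"]
  have "pfst y = f x" "psnd y = g x" unfolding justified_simps using "5.IH" by blast+
  then show ?case using pr_collapse[of y] by simp
next
  case (6 a f b g)
  from certificateD[OF assms(1) "6.prems"] show ?case
    unfolding justified_simps using "6.IH" by blast
next
  case (7 a f b g)
  \<comment> \<open>Facts about the recursion code itself at smaller arguments are outside the reach
    of the induction hypotheses, hence the inner induction on the recursion argument.\<close>
  have "fact (pr 6 (pr a b)) (pr u n) y \<in> D \<Longrightarrow>
    y = rec_nat (f u) (\<lambda>m r. g (pr u (pr m r))) n" for u n y
  proof (induction n arbitrary: y)
    case 0
    from certificateD[OF assms(1) 0] have "y = f u" unfolding justified_simps by (rule "7.IH"(1))
    then show ?case by simp
  next
    case (Suc n)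
    from certificateD[OF assms(1) Suc.prems] obtain r
      where "fact (pr 6 (pr a b)) (pr u n) r \<in> D" "fact b (pr u (pr n r)) y \<in> D"
      unfolding justified_simps by blast
    with Suc.IH[of r] "7.IH"(2)[of "pr u (pr n r)" y] show ?case by simp
  qed
  from this[of "pfst x" "psnd x" y] "7.prems" show ?case unfolding pr_collapse by blast
next
  case (8 a f b)
  from certificateD[OF assms(1) "8.prems"]
  have *: "fact a (pr x y) 0 \<in> D" "\<forall>z<y. \<exists>r. fact a (pr x z) r \<in> D \<and> r \<noteq> 0"
    unfolding justified_simps by blast+
  have "f (pr x y) = 0" using "8.IH"[OF *(1)] by simp
  moreover have "\<forall>z<y. f (pr x z) \<noteq> 0" using *(2) "8.IH" by metis
  ultimately have "(LEAST y. f (pr x y) = 0) = y"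
    by (intro Least_equality) (auto simp: not_less[symmetric])
  then show ?case by simp
next
  case (1 d)
  from certificateD[OF assms(1) "1.prems"] show ?case unfolding justified_simps .
next
  case (2 d)
  from certificateD[OF assms(1) "2.prems"] show ?case unfolding justified_simps .
next
  case (3 d)
  from certificateD[OF assms(1) "3.prems"] show ?case unfolding justified_simps .
next
  case (4 d)
  from certificateD[OF assms(1) "4.prems"] show ?case unfolding justified_simps .
qed

lemma certificate_step:
  assumes "finite D" "certificate D" "justified D c x y"
  shows "\<exists>D. finite D \<and> certificate D \<and> fact c x y \<in> D"
  using assms by (intro exI[of _ "insert (fact c x y) D"]) (simp add: certificate_insert)

text \<open>Certificates of subcomputations are merged by union and \<open>certificate_step\<close>
  adds the final fact. A minimization merges the certificates for all tested values up to the least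
  zero.\<close>

lemma certificate_complete:
  assumes "codes c f"
  shows "\<exists>D. finite D \<and> certificate D \<and> fact c x (f x) \<in> D"
  using assms
proof (induction arbitrary: x)
  case (5 a f b g)
  obtain D E where "finite D" "certificate D" "fact a x (f x) \<in> D"
    "finite E" "certificate E" "fact b x (g x) \<in> E"
    using "5.IH" by meson
  then show ?case
    by (intro certificate_step[of "D \<union> E"] certificate_Un) (simp_all add: justified_simps)
next
  case (6 a f b g)
  obtain D E where "finite D" "certificate D" "fact a (g x) (f (g x)) \<in> D"
    "finite E" "certificate E" "fact b x (g x) \<in> E"
    using "6.IH" by meson
  then show ?case
    by (intro certificate_step[of "D \<union> E"] certificate_Un) (auto simp: justified_simps)
next
  case (7 a f b g)
  have "\<exists>D. finite D \<and> certificate D \<and>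
    fact (pr 6 (pr a b)) (pr u n) (rec_nat (f u) (\<lambda>m r. g (pr u (pr m r))) n) \<in> D" for u n
  proof (induction n)
    case 0
    obtain D where "finite D" "certificate D" "fact a u (f u) \<in> D"
      using "7.IH" by meson
    then show ?case
      by (intro certificate_step[of D]) (simp_all add: justified_simps)
  next
    case (Suc n)
    define r where "r = rec_nat (f u) (\<lambda>m r. g (pr u (pr m r))) n"
    obtain D E where "finite D" "certificate D" "fact (pr 6 (pr a b)) (pr u n) r \<in> D"
      "finite E" "certificate E" "fact b (pr u (pr n r)) (g (pr u (pr n r))) \<in> E"
      using "7.IH" Suc.IH unfolding r_def by meson
    then show ?case
      by (intro certificate_step[of "D \<union> E"] certificate_Un)
        (auto simp: justified_simps simp flip: r_def)
  qed
  from this[of "pfst x" "psnd x"] show ?case by simp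
next
  case (8 a f b)
  define y where "y = (LEAST y. f (pr x y) = 0)"
  have y: "f (pr x y) = 0" "\<And>z. z < y \<Longrightarrow> f (pr x z) \<noteq> 0"
    unfolding y_def using LeastI_ex[of "\<lambda>y. f (pr x y) = 0"] "8.hyps" not_less_Least by blast+
  obtain D where D: "\<And>z. finite (D z)" "\<And>z. certificate (D z)"
    "\<And>z. fact a (pr x z) (f (pr x z)) \<in> D z"
    using "8.IH"[of "pr x z" for z] by (metis (no_types))
  have mem: "fact a (pr x z) (f (pr x z)) \<in> (\<Union>z\<le>y. D z)" if "z \<le> y" for z
    using D(3)[of z] that by blast
  have "certificate (\<Union>z\<le>y. D z)"
    using D(2) by (intro certificate_Union) auto
  moreover have "justified (\<Union>z\<le>y. D z) (pr 7 (pr a b)) x y"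
    unfolding justified_simps
  proof (intro conjI allI impI)
    show "fact a (pr x y) 0 \<in> (\<Union>z\<le>y. D z)" using mem[of y] y(1) by simp
    show "\<exists>r. fact a (pr x z) r \<in> (\<Union>z\<le>y. D z) \<and> r \<noteq> 0" if "z < y" for z
      using mem[of z] y(2) that by (intro exI[of _ "f (pr x z)"]) simp
  qed
  ultimately show ?case using D(1) unfolding y_def[symmetric]
    by (intro certificate_step[of "\<Union>z\<le>y. D z"]) auto
qed (rule certificate_step[of "{}"], simp, simp add: certificate_def, simp only: justified_simps)+

section \<open>Decidability of certificates\<close>

lemma set_decode_less: "n \<in> set_decode s \<Longrightarrow> n < s"
proof (rule ccontr)
  assume "n \<in> set_decode s" "\<not> n < s"
  then have "s < 2 ^ n" using less_exp[of n] by linarith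
  with \<open>n \<in> set_decode s\<close> show False by (simp add: set_decode_def)
qed

text \<open>A pair is at least each of its components, and the code of a finite set exceeds its
  elements. This bounds the existential quantifiers in \<open>justified\<close> and makes it
  decidable.\<close>

lemma fact_in_set_decode_less:
  assumes "fact c x y \<in> set_decode s" shows "y < s"
proof -
  have "y \<le> fact c x y"
    unfolding fact_def by (meson le_prod_encode_2 le_trans)
  then show ?thesis using set_decode_less[OF assms] by auto
qed

lemma computable_fact [comp_intros]:
  "computable a \<Longrightarrow> computable b \<Longrightarrow> computable c \<Longrightarrow>
    computable (\<lambda>x. fact (a x) (b x) (c x))"
  unfolding fact_def by (intro comp_intros)

lemma decidable_justified:
  "decidable (\<lambda>z. justified (set_decode (pfst z)) (pfst (psnd z)) (pfst (psnd (psnd z))) (psnd (psnd (psnd z))))"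
proof -
  have bounded: "(\<exists>z. fact c x z \<in> set_decode s \<and> P z) \<longleftrightarrow>
    (\<exists>z<s. fact c x z \<in> set_decode s \<and> P z)" for c x s P
    by (blast dest: fact_in_set_decode_less)
  show ?thesis unfolding justified_def bounded by (intro comp_intros)
qed

text \<open>Plays the part of Kleene's T predicate: \<open>s\<close> codes a certificate, and the
  output \<open>0\<close> counts as acceptance.\<close>

definition halts :: "nat \<Rightarrow> nat \<Rightarrow> nat \<Rightarrow> bool" where
  "halts c x s \<longleftrightarrow> certificate (set_decode s) \<and> fact c x 0 \<in> set_decode s"

lemma decidable_halts [comp_intros]:
  assumes "computable a" "computable b" "computable s"
  shows "decidable (\<lambda>x. halts (a x) (b x) (s x))"
proof -
  have "certificate (set_decode s) \<longleftrightarrow> (\<forall>p<s. p \<in> set_decode s \<longrightarrow>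
    justified (set_decode s) (pfst p) (pfst (psnd p)) (psnd (psnd p)))" for s
    unfolding certificate_def using set_decode_less by blast
  then have *: "halts c x s \<longleftrightarrow> fact c x 0 \<in> set_decode s \<and> (\<forall>p<s. p \<in> set_decode s \<longrightarrow>
    justified (set_decode s) (pfst p) (pfst (psnd p)) (psnd (psnd p)))" for c x s
    unfolding halts_def by blast
  show ?thesis
    by (rule decidable_app3[OF _ assms], unfold *)
      (intro comp_intros decidable_app4[OF decidable_justified])
qed

lemma halts_iff:
  assumes "codes c f" shows "(\<exists>s. halts c x s) \<longleftrightarrow> f x = 0"
proof
  show "f x = 0" if "\<exists>s. halts c x s"
    using that certificate_sound[OF _ assms] unfolding halts_def by metis
  assume "f x = 0"
  with certificate_complete[OF assms, of x] obtain D
    where "finite D" "certificate D" "fact c x 0 \<in> D" by auto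
  then show "\<exists>s. halts c x s"
    by (intro exI[of _ "set_encode D"]) (simp add: halts_def)
qed

section \<open>Open classes in terms of words\<close>

abbreviation bits :: "bool list \<Rightarrow> nat" where "bits \<equiv> horner_sum of_bool 2"

text \<open>The string \<open>X \<restriction> n\<close> is represented by the number with these bits, least significant first, so that
  prefixes are residues modulo powers of two.\<close>

definition word :: "cantor \<Rightarrow> nat \<Rightarrow> nat" where
  "word X n = bits (restr X n)"

lemma bit_bits: "bit (bits \<sigma>) i \<longleftrightarrow> i < length \<sigma> \<and> \<sigma> ! i"
  by (simp add: bit_horner_sum_bit_iff)

lemma bits_less: "bits \<sigma> < 2 ^ length \<sigma>"
  by (induction \<sigma>) auto

lemma bits_map_bit: "w < 2 ^ l \<Longrightarrow> bits (map (bit w) [0..<l]) = w"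
  by (simp add: horner_sum_bit_eq_take_bit take_bit_nat_eq_self)

lemma map_bit_bits: "map (bit (bits \<sigma>)) [0..<length \<sigma>] = \<sigma>"
  by (rule nth_equalityI) (auto simp: bit_bits)

lemma length_restr [simp]: "length (restr X n) = n"
  by (simp add: restr_def)

lemma take_restr: "m \<le> n \<Longrightarrow> take m (restr X n) = restr X m"
  by (simp add: restr_def take_map)

lemma bits_take: "bits (take n \<sigma>) = bits \<sigma> mod 2 ^ n"
  by (simp add: take_bit_horner_sum_bit_eq[symmetric] take_bit_eq_mod)

lemma bit_word: "bit (word X n) i \<longleftrightarrow> i < n \<and> X i"
  by (auto simp: word_def bit_bits restr_def)

lemma word_less [simp]: "word X n < 2 ^ n"
  using bits_less[of "restr X n"] by (simp add: word_def)

lemma word_mod: "m \<le> n \<Longrightarrow> word X n mod 2 ^ m = word X m"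
  by (simp add: word_def bits_take[symmetric] take_restr)

text \<open>The sequence \<open>bit w\<close> continues the word \<open>w\<close> by zeros; it is
  the standard point of a cylinder below.\<close>

lemma word_bit: "w < 2 ^ n \<Longrightarrow> word (bit w) n = w"
  by (simp add: word_def restr_def bits_map_bit)

lemma word_eq_iff: "word X n = word Y n \<longleftrightarrow> (\<forall>i<n. X i = Y i)"
  by (auto simp: bit_eq_iff bit_word)

section \<open>String codes and their translation from words\<close>

lemma string_code_Nil: "string_code [] = 0"
  and string_code_Cons: "string_code (b # \<sigma>) = Suc (pr (of_bool b) (string_code \<sigma>))"
  by (simp_all add: string_code_def)

lemma inj_string_code: "inj string_code"
proof
  fix \<sigma> \<tau> :: "bool list"
  assume "string_code \<sigma> = string_code \<tau>"
  then have "map of_bool \<sigma> = (map of_bool \<tau> :: nat list)"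
    unfolding string_code_def using list_encode_eq by blast
  then show "\<sigma> = \<tau>" by (rule map_injective) (simp add: inj_def)
qed

lemma length_le_string_code: "length \<sigma> \<le> string_code \<sigma>"
proof (induction \<sigma>)
  case (Cons b \<sigma>)
  then show ?case using le_prod_encode_2[of "string_code \<sigma>" "of_bool b"]
    by (simp add: string_code_Cons)
qed (simp add: string_code_Nil)

definition word_code :: "nat \<Rightarrow> nat \<Rightarrow> nat" where
  "word_code l w = string_code (map (bit w) [0..<l])"

lemma word_code_bits: "word_code (length \<sigma>) (bits \<sigma>) = string_code \<sigma>"
  by (simp add: word_code_def map_bit_bits)

lemma computable_word_code [comp_intros]:
  assumes "computable a" "computable b" shows "computable (\<lambda>x. word_code (a x) (b x))"
proof (rule computable_app2[OF _ assms])
  \<comment> \<open>A list code grows at its head, so the recursion reads the bits from the last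
    position downwards: after \<open>k\<close> steps it has coded the last \<open>k\<close>
    bits.\<close>
  define step where "step = (\<lambda>l w k r. Suc (pr (if l - Suc k \<in> set_decode w then 1 else 0) r))"
  have "k \<le> l \<Longrightarrow> rec_nat 0 (step l w) k = string_code (map (bit w) [l - k..<l])" for k l w
  proof (induction k)
    case (Suc k)
    then have "[l - Suc k..<l] = (l - Suc k) # [l - k..<l]"
      by (metis Suc_diff_Suc Suc_le_lessD diff_less upt_conv_Cons zero_less_Suc order.strict_trans1
          less_le_trans zero_less_iff_neq_zero less_nat_zero_code)
    with Suc show ?case
      by (simp add: step_def string_code_Cons set_decode_def bit_iff_odd)
  qed (simp add: string_code_Nil)
  from this[of l l for l] have "word_code l w = rec_nat 0 (step l w) l" for l w
    by (simp add: word_code_def)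
  moreover have "computable (\<lambda>z. rec_nat 0 (step (pfst z) (psnd z)) (pfst z))"
    unfolding step_def by (intro computable_rec comp_intros)
  ultimately show "computable (\<lambda>z. word_code (pfst z) (psnd z))" by simp
qed

text \<open>A string is no longer than its code, so only finitely many lengths and words have to be
  tested.\<close>

lemma decidable_string_code_image:
  assumes "decidable (\<lambda>z. P (pfst z) (pfst (psnd z)) (psnd (psnd z)))"
  shows "decidable (\<lambda>z. \<exists>\<sigma>. pfst z = string_code \<sigma> \<and> P (psnd z) (length \<sigma>) (bits \<sigma>))"
proof -
  have "(\<exists>\<sigma>. c = string_code \<sigma> \<and> Q (length \<sigma>) (bits \<sigma>)) \<longleftrightarrow>
    (\<exists>l\<le>c. \<exists>w<2 ^ l. word_code l w = c \<and> Q l w)" (is "?L \<longleftrightarrow> ?R") for c Q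
  proof
    assume ?L
    then show ?R using length_le_string_code bits_less word_code_bits by metis
  next
    assume ?R
    then obtain l w where "w < 2 ^ l" "word_code l w = c" "Q l w" by blast
    then show ?L
      by (intro exI[of _ "map (bit w) [0..<l]"]) (simp add: word_code_def bits_map_bit)
  qed
  then show ?thesis
    by (simp only:) (intro comp_intros decidable_app3[OF assms])
qed

lemma computable_matrix_bits:
  assumes "decidable (\<lambda>z. P (pfst z) (pfst (psnd z)) (psnd (psnd z)))"
  shows "computable_matrix {(\<sigma>, e). P e (length \<sigma>) (bits \<sigma>)}"
proof -
  have "z \<in> (\<lambda>(\<sigma>, e). pr (string_code \<sigma>) e) ` {(\<sigma>, e). P e (length \<sigma>) (bits \<sigma>)} \<longleftrightarrow>
    (\<exists>\<sigma>. pfst z = string_code \<sigma> \<and> P (psnd z) (length \<sigma>) (bits \<sigma>))" for z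
    by (auto simp: image_iff) (metis pr_collapse)
  with decidable_string_code_image[OF assms] show ?thesis
    by (simp add: computable_matrix_def computable_set_def decidable_def)
qed

lemma Sigma01_rel_words:
  assumes "decidable (\<lambda>z. P (pfst z) (pfst (psnd z)) (psnd (psnd z)))"
  shows "Sigma01_rel {(X, e). \<exists>n. P e n (word X n)}"
  unfolding Sigma01_rel_def using computable_matrix_bits[OF assms]
  by (intro exI[of _ "{(\<sigma>, e). P e (length \<sigma>) (bits \<sigma>)}"]) (simp add: word_def)

lemma Pi01_rel_words:
  assumes "decidable (\<lambda>z. P (pfst z) (pfst (psnd z)) (psnd (psnd z)))"
  shows "Pi01_rel {(X, e). \<forall>n. P e n (word X n)}"
  unfolding Pi01_rel_def using computable_matrix_bits[OF assms]
  by (intro exI[of _ "{(\<sigma>, e). P e (length \<sigma>) (bits \<sigma>)}"]) (simp add: word_def)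

text \<open>The tree for the complement keeps the strings none of whose prefixes satisfies
  \<open>P\<close>; testing all prefixes makes it closed under prefixes.\<close>

lemma Sigma01_class_words:
  assumes "decidable (\<lambda>z. P (pfst z) (psnd z))"
  shows "Sigma01_class {X. \<exists>n. P n (word X n)}"
proof -
  define T where "T = {\<sigma>. \<forall>m\<le>length \<sigma>. \<not> P m (bits \<sigma> mod 2 ^ m)}"
  have "decidable (\<lambda>z. \<exists>\<sigma>. pfst z = string_code \<sigma> \<and> (\<forall>m\<le>length \<sigma>. \<not> P m (bits \<sigma> mod 2 ^ m)))"
    by (intro decidable_string_code_image comp_intros decidable_app2[OF assms])
  from decidable_app1[OF this, of "\<lambda>x. pr x 0"]
  have "decidable (\<lambda>z. \<exists>\<sigma>. z = string_code \<sigma> \<and> \<sigma> \<in> T)"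
    by (simp add: T_def comp_intros)
  moreover have "z \<in> string_code ` T \<longleftrightarrow> (\<exists>\<sigma>. z = string_code \<sigma> \<and> \<sigma> \<in> T)" for z by blast
  ultimately have "computable_set (string_code ` T)"
    by (simp add: computable_set_def decidable_def)
  moreover have "\<sigma> \<in> T" if "prefix \<sigma> \<tau>" "\<tau> \<in> T" for \<sigma> \<tau>
  proof -
    have "\<sigma> = take (length \<sigma>) \<tau>" using that(1) by (auto simp: prefix_def)
    then have "bits \<sigma> mod 2 ^ m = bits \<tau> mod 2 ^ m" if "m \<le> length \<sigma>" for m
      using that bits_take by (metis min.absorb1 take_take)
    moreover have "length \<sigma> \<le> length \<tau>" using that(1) by (rule prefix_length_le)
    ultimately show ?thesis using that(2) by (simp add: T_def)
  qed
  ultimately have "computable_tree T" unfolding computable_tree_def by blast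
  moreover have "- {X. \<exists>n. P n (word X n)} = paths T"
    by (auto simp: paths_def T_def word_def[symmetric] word_mod)
  ultimately show ?thesis unfolding Sigma01_class_def Pi01_class_def by blast
qed

section \<open>A uniform enumeration of the open classes\<close>

text \<open>\<open>s\<close> bounds both the length of an enumerated prefix and its certificate, so
  the stage depends on \<open>s\<close> bits only. Every number \<open>c\<close> is allowed; one
  that codes no function still yields increasing stages.\<close>

definition sigma_word :: "nat \<Rightarrow> nat \<Rightarrow> nat \<Rightarrow> bool" where
  "sigma_word c s w \<longleftrightarrow> (\<exists>n\<le>s. \<exists>t\<le>s. halts c (pr n (w mod 2 ^ n)) t)"

lemma decidable_sigma_word [comp_intros]:
  assumes "computable a" "computable b" "computable c"
  shows "decidable (\<lambda>x. sigma_word (a x) (b x) (c x))"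
  by (rule decidable_app3[OF _ assms], unfold sigma_word_def) (intro comp_intros)

lemma mod_mod_power: "n \<le> s \<Longrightarrow> w mod 2 ^ s mod 2 ^ n = w mod 2 ^ n" for w :: nat
  by (simp add: mod_mod_cancel le_imp_power_dvd)

lemma sigma_word_mono: "sigma_word c s (w mod 2 ^ s) \<Longrightarrow> s \<le> s' \<Longrightarrow> sigma_word c s' w"
  unfolding sigma_word_def by (metis mod_mod_power order_trans)

text \<open>Take a code of the characteristic function of the tree of the complement. It vanishes
  exactly at the strings outside the tree, so \<open>halts\<close> enumerates the cylinders that
  make up \<open>U\<close>.\<close>

lemma Sigma01_class_sigma_word:
  assumes "Sigma01_class U"
  obtains c where "U = {X. \<exists>s. sigma_word c s (word X s)}"
proof -
  from assms obtain T where T: "computable_tree T" "- U = paths T"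
    unfolding Sigma01_class_def Pi01_class_def by blast
  have "decidable (\<lambda>z. z \<in> string_code ` T)"
    using T(1) by (simp add: computable_tree_def computable_set_def decidable_def)
  from decidable_app1[OF this, of "\<lambda>z. word_code (pfst z) (psnd z)"]
  have "computable (\<lambda>z. of_bool (word_code (pfst z) (psnd z) \<in> string_code ` T))"
    by (simp add: decidable_def comp_intros)
  then obtain c where c: "codes c (\<lambda>z. of_bool (word_code (pfst z) (psnd z) \<in> string_code ` T))"
    using codes_exists by blast
  have "(\<exists>t. halts c (pr n (word X n)) t) \<longleftrightarrow> restr X n \<notin> T" for X n
    using halts_iff[OF c, of "pr n (word X n)"] word_code_bits[of "restr X n"] inj_string_code
    by (simp add: word_def inj_image_mem_iff)
  then have "X \<in> U \<longleftrightarrow> (\<exists>n t. halts c (pr n (word X n)) t)" for X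
    using T(2) by (auto simp: paths_def set_eq_iff)
  moreover have "(\<exists>s. sigma_word c s (word X s)) \<longleftrightarrow> (\<exists>n t. halts c (pr n (word X n)) t)" for X
  proof
    assume "\<exists>s. sigma_word c s (word X s)"
    then show "\<exists>n t. halts c (pr n (word X n)) t" unfolding sigma_word_def using word_mod by metis
  next
    assume "\<exists>n t. halts c (pr n (word X n)) t"
    then obtain n t where "halts c (pr n (word X n)) t" by blast
    then have "sigma_word c (max n t) (word X (max n t))"
      unfolding sigma_word_def by (intro exI[of _ n] exI[of _ t] conjI) (auto simp: word_mod)
    then show "\<exists>s. sigma_word c s (word X s)" by blast
  qed
  ultimately show ?thesis by (intro that[of c]) blast
qed

section \<open>Compactness and measure\<close>

definition cyl :: "nat \<Rightarrow> nat \<Rightarrow> cantor set" where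
  "cyl n v = {X. word X n = v}"

text \<open>Koenig's lemma is applied to the words that have, for every stage, an extension in
  \<open>Q\<close> not yet covered: an infinite branch would satisfy \<open>Q\<close> and escape all
  stages. This is the compactness of Cantor space in the form used below.\<close>

lemma koenig:
  assumes mono: "\<And>s s' X. s \<le> s' \<Longrightarrow> P s (word X s) \<Longrightarrow> P s' (word X s')"
    and cover: "\<And>X. Q (word X n) \<Longrightarrow> \<exists>s. P s (word X s)"
  obtains s where "\<And>X. Q (word X n) \<Longrightarrow> P s (word X s)"
proof (rule ccontr)
  define A where "A s X \<longleftrightarrow> Q (word X n) \<and> \<not> P s (word X s)" for s X
  \<comment> \<open>\<open>G l Y\<close> names a bad node: no single stage covers all points of
    \<open>Q\<close> that share the first \<open>l\<close> bits of \<open>Y\<close>.\<close>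
  define G where "G l Y \<longleftrightarrow> (\<forall>s. \<exists>X. word X l = word Y l \<and> A s X)" for l and Y :: cantor
  assume "\<not> thesis"
  with that have G0: "G 0 Y" for Y unfolding G_def A_def word_eq_iff by blast
  have A_mono: "A s X" if "A s' X" "s \<le> s'" for s s' X
    using that mono unfolding A_def by blast
  \<comment> \<open>If neither successor were bad, the larger of their two stages would cover the
    node.\<close>
  have step: "\<exists>b. G (Suc l) (Y(l := b))" if GY: "G l Y" for l Y
  proof (rule ccontr)
    assume "\<nexists>b. G (Suc l) (Y(l := b))"
    then have none: "\<exists>s. \<forall>X. word X (Suc l) = word (Y(l := b)) (Suc l) \<longrightarrow> \<not> A s X" for b
      unfolding G_def by blast
    obtain s where s: "\<And>X. word X (Suc l) = word (Y(l := True)) (Suc l) \<Longrightarrow> \<not> A s X"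
      using none[of True] by blast
    obtain t where t: "\<And>X. word X (Suc l) = word (Y(l := False)) (Suc l) \<Longrightarrow> \<not> A t X"
      using none[of False] by blast
    obtain X where X: "word X l = word Y l" "A (max s t) X"
      using GY unfolding G_def by blast
    have "word X (Suc l) = word (Y(l := X l)) (Suc l)"
      using X(1) by (auto simp: word_eq_iff less_Suc_eq)
    moreover have "A s X" "A t X" using A_mono[OF X(2)] by simp_all
    ultimately show False using s[of X] t[of X] by (cases "X l") auto
  qed
  define f where "f = rec_nat (\<lambda>_. False) (\<lambda>l Y. Y(l := (SOME b. G (Suc l) (Y(l := b)))))"
  have f_Suc: "f (Suc l) = (f l)(l := (SOME b. G (Suc l) ((f l)(l := b))))" for l
    by (simp add: f_def)
  have G: "G l (f l)" for l
  proof (induction l)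
    case 0
    show ?case by (rule G0)
  next
    case (Suc l)
    from someI_ex[OF step[OF Suc]] show ?case unfolding f_Suc .
  qed
  define Z where "Z i = f (Suc i) i" for i
  have "i < l \<Longrightarrow> f l i = Z i" for i l
    by (induction l) (auto simp: f_Suc Z_def less_Suc_eq)
  then have Z: "word (f l) l = word Z l" for l
    by (simp add: word_eq_iff)
  \<comment> \<open>Badness at level \<open>n\<close> puts the branch \<open>Z\<close> into
    \<open>Q\<close>, so some stage \<open>s\<close> covers it. Stage \<open>s\<close> reads only
    \<open>s\<close> bits, so badness at level \<open>s\<close> contradicts this.\<close>
  obtain X where "word X n = word Z n" "Q (word X n)"
    using G[of n] unfolding G_def A_def Z by blast
  then obtain s where "P s (word Z s)" using cover by metis
  moreover obtain X where "word X s = word Z s" "\<not> P s (word X s)"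
    using G[of s] unfolding G_def A_def Z by blast
  ultimately show False by simp
qed

section \<open>The coin measure on clopen sets\<close>

lemma prob_space_coin: "prob_space coin_measure"
  unfolding coin_measure_def by (intro prob_space_PiM measure_pmf.prob_space_axioms)

interpretation coin: prob_space coin_measure
  by (rule prob_space_coin)

lemma space_coin [simp]: "space coin_measure = UNIV"
  by (simp add: coin_measure_def space_PiM PiE_UNIV_domain)

lemma cyl_eq_prod_emb:
  assumes "v < 2 ^ n"
  shows "cyl n v = prod_emb UNIV (\<lambda>_. measure_pmf (bernoulli_pmf (1/2))) {..<n} (\<Pi>\<^sub>E i\<in>{..<n}. {bit v i})"
proof -
  have "word X n = v \<longleftrightarrow> (\<forall>i\<in>{..<n}. X i \<in> {bit v i})" for X
    using word_eq_iff[of X n "bit v"] word_bit[OF assms] by (simp add: Ball_def)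
  then show ?thesis
    unfolding cyl_def prod_emb_def vimage_def restrict_PiE_iff by (simp add: PiE_UNIV_domain)
qed

lemma sets_cyl [measurable]:
  assumes "v < 2 ^ n" shows "cyl n v \<in> sets coin_measure"
  unfolding cyl_eq_prod_emb[OF assms] coin_measure_def
  by (intro sets_PiM_I) auto

lemma measure_cyl:
  assumes "v < 2 ^ n" shows "measure coin_measure (cyl n v) = 1 / 2 ^ n"
proof -
  interpret P: product_prob_space "\<lambda>_. measure_pmf (bernoulli_pmf (1/2))" UNIV
    by unfold_locales
  have "measure coin_measure (cyl n v) =
    (\<Prod>i<n. measure (measure_pmf (bernoulli_pmf (1/2))) {bit v i})"
    unfolding cyl_eq_prod_emb[OF assms] coin_measure_def
    by (intro P.measure_PiM_emb) auto
  also have "\<dots> = (1 / 2) ^ n"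
    by (simp add: measure_pmf_single)
  finally show ?thesis by (simp add: power_one_over)
qed

lemma words_eq_UN_cyl: "{X. P (word X n)} = (\<Union>w\<in>{w. w < 2 ^ n \<and> P w}. cyl n w)"
  by (auto simp: cyl_def)

lemma sets_words [measurable]: "{X. P (word X n)} \<in> sets coin_measure"
  unfolding words_eq_UN_cyl by (intro sets.finite_UN) auto

lemma measure_words:
  "measure coin_measure {X. P (word X n)} = card {w. w < 2 ^ n \<and> P w} / 2 ^ n"
proof -
  have "measure coin_measure {X. P (word X n)} =
    (\<Sum>w\<in>{w. w < 2 ^ n \<and> P w}. measure coin_measure (cyl n w))"
    unfolding words_eq_UN_cyl
    by (intro coin.finite_measure_finite_Union) (auto simp: disjoint_family_on_def cyl_def[abs_def] sets_cyl[unfolded cyl_def])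
  also have "\<dots> = (\<Sum>w\<in>{w. w < 2 ^ n \<and> P w}. 1 / 2 ^ n)"
    by (intro sum.cong) (auto simp: measure_cyl)
  finally show ?thesis by simp
qed

lemma measure_Compl_cyl:
  assumes "v < 2 ^ n" shows "measure coin_measure (- cyl n v) = 1 - 1 / 2 ^ n"
  using coin.prob_compl[OF sets_cyl[OF assms]] measure_cyl[OF assms] by (simp add: Compl_eq_Diff_UNIV)

section \<open>Enumerating the open classes that are not complements of cylinders\<close>

definition sigma_stage :: "nat \<Rightarrow> nat \<Rightarrow> cantor set" where
  "sigma_stage c s = {X. sigma_word c s (word X s)}"

definition co_cylinders :: "cantor set set" where
  "co_cylinders = {- cyl n v |n v. 1 \<le> n \<and> v < 2 ^ n}"

text \<open>Lengths up to \<open>s\<close> suffice: a set that depends on \<open>s\<close> bits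
  cannot be the complement of a cylinder of greater length. The bounded form is decidable.\<close>

definition is_co_cylinder :: "nat \<Rightarrow> nat \<Rightarrow> bool" where
  "is_co_cylinder c s \<longleftrightarrow>
     (\<exists>n\<le>s. 1 \<le> n \<and> (\<exists>v<2 ^ n. \<forall>w<2 ^ s.
       (sigma_word c s w \<longrightarrow> \<not> w mod 2 ^ n = v) \<and>
       (\<not> w mod 2 ^ n = v \<longrightarrow> sigma_word c s w)))"

text \<open>\<open>j\<close> pairs the index of an open class with an exponent \<open>k\<close>. The
  inequality bounds the measure of the stage by \<open>1 - 1 / 2 ^ k\<close>, multiplied by
  \<open>2 ^ (s + k)\<close> to stay within the natural numbers.\<close>

definition good :: "nat \<Rightarrow> nat \<Rightarrow> bool" where
  "good j s \<longleftrightarrow> (\<Sum>w<2 ^ s. of_bool (sigma_word (pfst j) s w)) * 2 ^ psnd j + 2 ^ s \<le> (2 ^ (s + psnd j) :: nat)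
     \<and> \<not> is_co_cylinder (pfst j) s"

text \<open>A rejected stage is not lost if a later one is accepted, since stages increase.\<close>

definition filtered_word :: "nat \<Rightarrow> nat \<Rightarrow> nat \<Rightarrow> bool" where
  "filtered_word j s w \<longleftrightarrow> (\<exists>t\<le>s. good j t \<and> sigma_word (pfst j) t (w mod 2 ^ t))"

definition filtered_stage :: "nat \<Rightarrow> nat \<Rightarrow> cantor set" where
  "filtered_stage j s = {X. filtered_word j s (word X s)}"

definition filtered_class :: "nat \<Rightarrow> cantor set" where
  "filtered_class j = (\<Union>s. filtered_stage j s)"

lemma decidable_good [comp_intros]:
  assumes "computable a" "computable b" shows "decidable (\<lambda>x. good (a x) (b x))"
proof -
  have "computable (\<lambda>x. \<Sum>w<2 ^ b x. of_bool (sigma_word (pfst (a x)) (b x) w) :: nat)"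
  proof (rule computable_sum)
    have "decidable (\<lambda>z. sigma_word (pfst (a (pfst z))) (b (pfst z)) (psnd z))"
      by (intro comp_intros computable_app1[OF assms(1)] computable_app1[OF assms(2)])
    then show "computable (\<lambda>z. of_bool (sigma_word (pfst (a (pfst z))) (b (pfst z)) (psnd z)))"
      by (simp add: decidable_def)
  qed (intro comp_intros assms)
  moreover have "decidable (\<lambda>z. is_co_cylinder (pfst (a z)) (b z))"
    unfolding is_co_cylinder_def
    by (intro comp_intros computable_app1[OF assms(1)] computable_app1[OF assms(2)])
  ultimately show ?thesis unfolding good_def by (intro comp_intros assms)
qed

lemma decidable_filtered_word [comp_intros]:
  assumes "computable a" "computable b" "computable c"
  shows "decidable (\<lambda>x. filtered_word (a x) (b x) (c x))"
  by (rule decidable_app3[OF _ assms], unfold filtered_word_def) (intro comp_intros)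

section \<open>Stages and measure of the filtered classes\<close>

lemma sigma_stage_mono: "s \<le> t \<Longrightarrow> sigma_stage c s \<subseteq> sigma_stage c t"
  unfolding sigma_stage_def using sigma_word_mono[of c s "word X t" t for X] by (auto simp: word_mod)

lemma filtered_stage_eq: "filtered_stage j s = (\<Union>t\<in>{t. t \<le> s \<and> good j t}. sigma_stage (pfst j) t)"
proof -
  have "filtered_word j s (word X s) \<longleftrightarrow> (\<exists>t. (t \<le> s \<and> good j t) \<and> sigma_word (pfst j) t (word X t))" for X
    unfolding filtered_word_def by (simp add: word_mod cong: conj_cong)
  then show ?thesis by (simp add: filtered_stage_def sigma_stage_def set_eq_iff)
qed

lemma filtered_stage_mono: "s \<le> t \<Longrightarrow> filtered_stage j s \<subseteq> filtered_stage j t"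
  unfolding filtered_stage_eq by (intro UN_mono) auto

text \<open>The stages increase, so the union of the accepted ones up to \<open>s\<close> is the
  last of them. A nonempty filtered stage thus inherits both properties tested by
  \<open>good\<close>.\<close>

lemma filtered_stage_cases: "filtered_stage j s = {} \<or> (\<exists>t\<le>s. good j t \<and> filtered_stage j s = sigma_stage (pfst j) t)"
proof (cases "{t. t \<le> s \<and> good j t} = {}")
  case True
  then show ?thesis unfolding filtered_stage_eq by blast
next
  case False
  define m where "m = Max {t. t \<le> s \<and> good j t}"
  have "m \<in> {t. t \<le> s \<and> good j t}"
    unfolding m_def using False by (intro Max_in) auto
  then have m: "m \<le> s" "good j m" by simp_all
  have "t \<le> m" if "t \<in> {t. t \<le> s \<and> good j t}" for t
    unfolding m_def using that by (intro Max_ge) auto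
  then have "filtered_stage j s \<subseteq> sigma_stage (pfst j) m"
    unfolding filtered_stage_eq by (intro UN_least sigma_stage_mono)
  moreover have "sigma_stage (pfst j) m \<subseteq> filtered_stage j s"
    unfolding filtered_stage_eq using m by (intro UN_upper) simp
  ultimately show ?thesis using m by blast
qed

lemma is_co_cylinder_iff: "is_co_cylinder c s \<longleftrightarrow> sigma_stage c s \<in> co_cylinders"
proof
  assume "is_co_cylinder c s"
  then obtain n v where *: "n \<le> s" "1 \<le> n" "v < 2 ^ n" "\<forall>w<2 ^ s. sigma_word c s w \<longleftrightarrow> w mod 2 ^ n \<noteq> v"
    unfolding is_co_cylinder_def by blast
  have "sigma_word c s (word X s) \<longleftrightarrow> word X n \<noteq> v" for X
    using *(4)[rule_format, of "word X s"] *(1) by (simp add: word_mod)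
  then have "sigma_stage c s = - cyl n v" by (auto simp: sigma_stage_def cyl_def)
  then show "sigma_stage c s \<in> co_cylinders" using *(2,3) unfolding co_cylinders_def by blast
next
  assume "sigma_stage c s \<in> co_cylinders"
  then obtain n v where *: "1 \<le> n" "v < 2 ^ n" "sigma_stage c s = - cyl n v"
    unfolding co_cylinders_def by blast
  have iff: "sigma_word c s (word X s) \<longleftrightarrow> word X n \<noteq> v" for X
    using *(3) by (auto simp: sigma_stage_def cyl_def)
  have "n \<le> s"
  proof (rule ccontr)
    assume "\<not> n \<le> s"
    \<comment> \<open>\<open>X\<close> and \<open>Y\<close> differ only at position
      \<open>n - 1\<close>, which is at least \<open>s\<close>: the stage cannot tell them apart,
      but only \<open>X\<close> lies in the cylinder.\<close>
    define X Y where "X = bit v" and "Y = X(n - 1 := \<not> X (n - 1))"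
    have "word X s = word Y s"
      using \<open>\<not> n \<le> s\<close> by (auto simp: word_eq_iff Y_def)
    moreover have "word X n \<noteq> word Y n"
      using *(1) unfolding word_eq_iff Y_def by (auto intro!: exI[of _ "n - 1"])
    moreover have "word X n = v" using *(2) by (simp add: X_def word_bit)
    ultimately show False using iff[of X] iff[of Y] by simp
  qed
  moreover have "sigma_word c s w \<longleftrightarrow> w mod 2 ^ n \<noteq> v" if "w < 2 ^ s" for w
    using iff[of "bit w"] word_bit[OF that] word_mod[OF \<open>n \<le> s\<close>, of "bit w"] by simp
  ultimately show "is_co_cylinder c s"
    unfolding is_co_cylinder_def using *(1,2) by blast
qed

lemma sets_sigma_stage [measurable]: "sigma_stage c s \<in> sets coin_measure"
  unfolding sigma_stage_def by (rule sets_words)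

lemma sets_filtered_stage [measurable]: "filtered_stage j s \<in> sets coin_measure"
  unfolding filtered_stage_def by (rule sets_words)

lemma sets_filtered_class [measurable]: "filtered_class j \<in> sets coin_measure"
  unfolding filtered_class_def by (intro sets.countable_UN) auto

lemma measure_sigma_stage: "measure coin_measure (sigma_stage c s) = (\<Sum>w<2 ^ s. of_bool (sigma_word c s w) :: nat) / 2 ^ s"
proof -
  have "{..<2 ^ s} \<inter> Collect (sigma_word c s) = {w. w < 2 ^ s \<and> sigma_word c s w}" by auto
  then show ?thesis unfolding sigma_stage_def measure_words by simp
qed

lemma good_iff:
  "good j s \<longleftrightarrow> measure coin_measure (sigma_stage (pfst j) s) \<le> 1 - 1 / 2 ^ psnd j \<and> sigma_stage (pfst j) s \<notin> co_cylinders"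
proof -
  define m :: nat where "m = (\<Sum>w<2 ^ s. of_bool (sigma_word (pfst j) s w))"
  have "m * 2 ^ psnd j + 2 ^ s \<le> 2 ^ (s + psnd j) \<longleftrightarrow>
    real (m * 2 ^ psnd j + 2 ^ s) \<le> real (2 ^ (s + psnd j))"
    by (simp only: of_nat_le_iff)
  also have "\<dots> \<longleftrightarrow> m / 2 ^ s \<le> 1 - 1 / 2 ^ psnd j"
    by (simp add: field_simps power_add)
  finally show ?thesis
    unfolding good_def is_co_cylinder_iff measure_sigma_stage m_def by simp
qed

lemma measure_filtered_stage: "measure coin_measure (filtered_stage j s) \<le> 1 - 1 / 2 ^ psnd j"
  using filtered_stage_cases[of j s] good_iff by (auto simp: field_simps)

text \<open>The bound \<open>1 - 1 / 2 ^ psnd j\<close> is the same for all stages, so it passes to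
  the limit and keeps the measure away from 1.\<close>

lemma measure_filtered_class: "measure coin_measure (filtered_class j) < 1"
proof -
  have "(\<lambda>s. measure coin_measure (filtered_stage j s)) \<longlonglongrightarrow> measure coin_measure (filtered_class j)"
    unfolding filtered_class_def
    by (intro coin.finite_Lim_measure_incseq) (auto simp: mono_def filtered_stage_mono)
  then have "measure coin_measure (filtered_class j) \<le> 1 - 1 / 2 ^ psnd j"
    using measure_filtered_stage by (intro LIMSEQ_le_const2) auto
  also have "\<dots> < 1" by simp
  finally show ?thesis .
qed

lemma filtered_word_not_full: "\<exists>w<2 ^ t. \<not> filtered_word j t w"
proof (rule ccontr)
  assume "\<not> ?thesis"
  then have "filtered_stage j t = UNIV" by (auto simp: filtered_stage_def)
  then have "measure coin_measure (filtered_stage j t) = 1" using coin.prob_space by simp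
  moreover have "0 < 1 / (2 :: real) ^ psnd j" by simp
  ultimately show False using measure_filtered_stage[of j t] by linarith
qed

lemma filtered_class_compact:
  assumes "\<And>X. Q (word X n) \<Longrightarrow> X \<in> filtered_class j"
  shows "\<exists>s. \<forall>X. Q (word X n) \<longrightarrow> X \<in> filtered_stage j s"
proof -
  have "filtered_word j t (word X t)" if "s \<le> t" "filtered_word j s (word X s)" for s t X
    using filtered_stage_mono[OF that(1), of j] that(2) by (auto simp: filtered_stage_def)
  moreover have "\<exists>s. filtered_word j s (word X s)" if "Q (word X n)" for X
    using assms[OF that] by (auto simp: filtered_class_def filtered_stage_def)
  ultimately obtain s where "\<And>X. Q (word X n) \<Longrightarrow> filtered_word j s (word X s)"
    using koenig[of "filtered_word j" Q n] by blast
  then have "\<forall>X. Q (word X n) \<longrightarrow> X \<in> filtered_stage j s" by (simp add: filtered_stage_def)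
  then show ?thesis ..
qed

text \<open>A co-cylinder is clopen, so by compactness it would already be a stage. A nonempty stage
  is an accepted one, and \<open>good\<close> rejects co-cylinders.\<close>

lemma filtered_class_not_co_cylinder: "filtered_class j \<notin> co_cylinders"
proof
  assume co: "filtered_class j \<in> co_cylinders"
  then obtain n v where *: "1 \<le> n" "v < 2 ^ n" "filtered_class j = - cyl n v"
    unfolding co_cylinders_def by blast
  have "\<exists>s. \<forall>X. word X n \<noteq> v \<longrightarrow> X \<in> filtered_stage j s"
    by (rule filtered_class_compact) (simp add: *(3) cyl_def)
  then obtain s where s: "\<forall>X. word X n \<noteq> v \<longrightarrow> X \<in> filtered_stage j s" ..
  then have "- cyl n v \<subseteq> filtered_stage j s" by (auto simp: cyl_def)
  moreover have "filtered_stage j s \<subseteq> filtered_class j" unfolding filtered_class_def by blast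
  ultimately have eq: "filtered_stage j s = - cyl n v" using *(3) by blast
  \<comment> \<open>The empty set is a possible stage; \<open>1 \<le> n\<close> gives the
    co-cylinder positive measure and excludes this case.\<close>
  have "1 < (2 :: real) ^ n" using *(1) by (intro one_less_power) auto
  then have "measure coin_measure (filtered_stage j s) \<noteq> 0"
    unfolding eq measure_Compl_cyl[OF *(2)] by simp
  then have "filtered_stage j s \<noteq> {}" by auto
  with filtered_stage_cases[of j s] obtain t where "good j t" "filtered_stage j s = sigma_stage (pfst j) t" by blast
  then show False using co by (simp add: good_iff eq *(3))
qed

section \<open>Completeness of the two families\<close>

text \<open>Choose \<open>k\<close> such that the measure bound never rejects a stage of
  \<open>U\<close>. If infinitely many stages are not co-cylinders, these exhaust \<open>U\<close>;
  otherwise the stages are eventually one fixed co-cylinder, which is \<open>U\<close>.\<close>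

lemma Sigma01_class_cases:
  assumes "Sigma01_class U" "measure coin_measure U < 1"
  shows "U \<in> co_cylinders \<or> U \<in> range filtered_class"
proof -
  obtain c where "U = {X. \<exists>s. sigma_word c s (word X s)}" using Sigma01_class_sigma_word[OF assms(1)] .
  then have U: "U = (\<Union>s. sigma_stage c s)" by (auto simp: sigma_stage_def)
  obtain k where "(1 / 2) ^ k < 1 - measure coin_measure U"
    using real_arch_pow_inv[of "1 - measure coin_measure U" "1 / 2"] assms(2) by auto
  then have k: "measure coin_measure U \<le> 1 - 1 / 2 ^ k" by (simp add: power_one_over)
  have "U \<in> sets coin_measure" unfolding U by (intro sets.countable_UN) auto
  then have sigma_stage_le: "measure coin_measure (sigma_stage c s) \<le> 1 - 1 / 2 ^ k" for s
    using coin.finite_measure_mono[of "sigma_stage c s" U] k U by fastforce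
  show ?thesis
  proof (cases "\<forall>s. \<exists>t\<ge>s. sigma_stage c t \<notin> co_cylinders")
    case True
    have "good (pr c k) t \<longleftrightarrow> sigma_stage c t \<notin> co_cylinders" for t
      unfolding good_iff using sigma_stage_le by simp
    then have "filtered_class (pr c k) = (\<Union>t\<in>{t. sigma_stage c t \<notin> co_cylinders}. sigma_stage c t)"
      unfolding filtered_class_def filtered_stage_eq by auto
    moreover have "U \<subseteq> (\<Union>t\<in>{t. sigma_stage c t \<notin> co_cylinders}. sigma_stage c t)"
      unfolding U
    proof (rule UN_least)
      fix s
      obtain t where "t \<ge> s" "sigma_stage c t \<notin> co_cylinders" using True by blast
      then show "sigma_stage c s \<subseteq> (\<Union>t\<in>{t. sigma_stage c t \<notin> co_cylinders}. sigma_stage c t)"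
        using sigma_stage_mono[of s t c] by blast
    qed
    ultimately have "U = filtered_class (pr c k)" unfolding U by blast
    then show ?thesis by blast
  next
    case False
    then obtain s0 where co: "\<And>t. t \<ge> s0 \<Longrightarrow> sigma_stage c t \<in> co_cylinders" by blast
    have "\<forall>t. \<exists>p. t \<ge> s0 \<longrightarrow> snd p < 2 ^ fst p \<and> sigma_stage c t = - cyl (fst p) (snd p)"
      using co unfolding co_cylinders_def by fastforce
    from choice[OF this] obtain p where p:
      "\<forall>t. t \<ge> s0 \<longrightarrow> snd (p t) < 2 ^ fst (p t) \<and> sigma_stage c t = - cyl (fst (p t)) (snd (p t))" ..
    define n v where "n t = fst (p t)" and "v t = snd (p t)" for t
    have nv: "v t < 2 ^ n t" "sigma_stage c t = - cyl (n t) (v t)" if "t \<ge> s0" for t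
      using p that by (simp_all add: n_def v_def)
    \<comment> \<open>A co-cylinder of length \<open>n t\<close> has measure
      \<open>1 - 1 / 2 ^ n t\<close>, so the measure bound limits the lengths.\<close>
    have "n t \<le> k" if "t \<ge> s0" for t
    proof -
      have "1 - 1 / 2 ^ n t \<le> (1 - 1 / 2 ^ k :: real)"
        using sigma_stage_le[of t] nv(1,2)[OF that] measure_Compl_cyl by simp
      then have "(2 :: real) ^ n t \<le> 2 ^ k" by (simp add: divide_le_cancel frac_le_eq field_simps)
      then show ?thesis by simp
    qed
    then have "n ` {s0..} \<subseteq> {..k}" by (simp add: image_subset_iff)
    then have fin: "finite (n ` {s0..})" by (rule finite_subset) simp
    have "Max (n ` {s0..}) \<in> n ` {s0..}" using fin by (rule Max_in) simp
    then obtain s where Max_eq: "Max (n ` {s0..}) = n s" and "s \<in> {s0..}" by (rule imageE)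
    then have s: "s \<ge> s0" by simp
    have n_le: "n t \<le> n s" if "t \<ge> s0" for t
      using Max_ge[OF fin, of "n t"] that unfolding Max_eq by simp
    \<comment> \<open>A later stage omits a cylinder contained in the one omitted at
      \<open>s\<close>. Its length is no greater because \<open>n s\<close> is maximal, so the two
      cylinders coincide.\<close>
    have "sigma_stage c t \<subseteq> sigma_stage c s" if "t \<ge> s" for t
    proof -
      have t: "t \<ge> s0" using that s by simp
      have "cyl (n t) (v t) \<subseteq> cyl (n s) (v s)"
        using sigma_stage_mono[OF that, of c] nv(2)[OF t] nv(2)[OF s] by simp
      moreover have "bit (v t) \<in> cyl (n t) (v t)"
        using word_bit[OF nv(1)[OF t]] by (simp add: cyl_def)
      ultimately have "bit (v t) \<in> cyl (n s) (v s)" by (rule subsetD)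
      then have "word (bit (v t)) (n s) = v s" by (simp add: cyl_def)
      then have "v t = v s mod 2 ^ n t"
        using word_bit[OF nv(1)[OF t]] word_mod[OF n_le[OF t], of "bit (v t)"] by simp
      then have "cyl (n s) (v s) \<subseteq> cyl (n t) (v t)"
        using word_mod[OF n_le[OF t]] unfolding cyl_def by (intro Collect_mono impI) metis
      then show ?thesis using nv(2)[OF t] nv(2)[OF s] by simp
    qed
    then have "sigma_stage c t \<subseteq> sigma_stage c s" for t using sigma_stage_mono[of t s c] linear[of t s] by blast
    then have "U \<subseteq> sigma_stage c s" unfolding U by (intro UN_least)
    then have "U = sigma_stage c s" unfolding U by blast
    then show ?thesis using co[OF s] by simp
  qed
qed

section \<open>The Friedberg numbering\<close>

text \<open>\<open>n\<close> is the precision of the evidence and \<open>t\<close> the time at which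
  it is seen; \<open>n \<le> t\<close> makes matches of unbounded precision occur at unbounded
  times.\<close>

definition matching :: "nat \<Rightarrow> nat \<Rightarrow> nat \<Rightarrow> nat \<Rightarrow> bool" where
  "matching i j n t \<longleftrightarrow> n \<le> t \<and>
     (\<forall>w<2 ^ t. (filtered_word i n (w mod 2 ^ n) \<longrightarrow> filtered_word j t w) \<and>
       (filtered_word j n (w mod 2 ^ n) \<longrightarrow> filtered_word i t w))"

definition first_match :: "nat \<Rightarrow> nat \<Rightarrow> nat \<Rightarrow> nat \<Rightarrow> bool" where
  "first_match i j n t \<longleftrightarrow> matching i j n t \<and> (\<forall>u<t. \<not> matching i j n u)"

text \<open>Only first matches count, so each pair of \<open>i\<close> and \<open>n\<close>
  contributes at most one change. Stage \<open>0\<close> is included so that every \<open>j\<close>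
  has a follower.\<close>

definition change :: "nat \<Rightarrow> nat \<Rightarrow> bool" where
  "change j t \<longleftrightarrow> t = 0 \<or> (\<exists>i<j. \<exists>n\<le>t. first_match i j n t)"

lemma decidable_matching [comp_intros]:
  assumes "computable a" "computable b" "computable c" "computable d"
  shows "decidable (\<lambda>x. matching (a x) (b x) (c x) (d x))"
  by (rule decidable_app4[OF _ assms], unfold matching_def) (intro comp_intros)

lemma decidable_first_match [comp_intros]:
  assumes "computable a" "computable b" "computable c" "computable d"
  shows "decidable (\<lambda>x. first_match (a x) (b x) (c x) (d x))"
  by (rule decidable_app4[OF _ assms], unfold first_match_def) (intro comp_intros)

lemma decidable_change [comp_intros]:
  assumes "computable a" "computable b" shows "decidable (\<lambda>x. change (a x) (b x))"
  by (rule decidable_app2[OF _ assms], unfold change_def) (intro comp_intros)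

lemma matching_iff:
  "matching i j n t \<longleftrightarrow> n \<le> t \<and> filtered_stage i n \<subseteq> filtered_stage j t \<and> filtered_stage j n \<subseteq> filtered_stage i t"
proof (cases "n \<le> t")
  case True
  have "(\<forall>w<2 ^ t. filtered_word i n (w mod 2 ^ n) \<longrightarrow> filtered_word j t w) \<longleftrightarrow> filtered_stage i n \<subseteq> filtered_stage j t" for i j
  proof
    show "filtered_stage i n \<subseteq> filtered_stage j t" if "\<forall>w<2 ^ t. filtered_word i n (w mod 2 ^ n) \<longrightarrow> filtered_word j t w"
      using that[rule_format, of "word X t" for X] True by (auto simp: filtered_stage_def word_mod)
    show "\<forall>w<2 ^ t. filtered_word i n (w mod 2 ^ n) \<longrightarrow> filtered_word j t w" if sub: "filtered_stage i n \<subseteq> filtered_stage j t"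
    proof (intro allI impI)
      fix w :: nat assume "w < 2 ^ t" "filtered_word i n (w mod 2 ^ n)"
      then have "bit w \<in> filtered_stage i n"
        using word_mod[OF True, of "bit w"] by (simp add: filtered_stage_def word_bit)
      then have "bit w \<in> filtered_stage j t" using sub by (rule rev_subsetD)
      then show "filtered_word j t w" using \<open>w < 2 ^ t\<close> by (simp add: filtered_stage_def word_bit)
    qed
  qed
  from this[of i j] this[of j i] True show ?thesis unfolding matching_def by blast
qed (simp add: matching_def)

lemma ex_matching:
  assumes "filtered_class i = filtered_class j" shows "\<exists>t. matching i j n t"
proof -
  have "\<exists>s. filtered_stage i n \<subseteq> filtered_stage j s" if "filtered_class i = filtered_class j" for i j
  proof -
    have "filtered_stage i n \<subseteq> filtered_class i" unfolding filtered_class_def by (rule UN_upper) simp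
    then have "filtered_stage i n \<subseteq> filtered_class j" unfolding that .
    then have "\<exists>s. \<forall>X. filtered_word i n (word X n) \<longrightarrow> X \<in> filtered_stage j s"
      by (intro filtered_class_compact) (auto simp: filtered_stage_def)
    then show ?thesis unfolding filtered_stage_def[of i] by blast
  qed
  from this[of i j] this[of j i] assms obtain s t where "filtered_stage i n \<subseteq> filtered_stage j s" "filtered_stage j n \<subseteq> filtered_stage i t"
    by auto
  then have "matching i j n (n + s + t)"
    using filtered_stage_mono[of s "n + s + t" j] filtered_stage_mono[of t "n + s + t" i]
    unfolding matching_iff by simp (meson order_trans)
  then show ?thesis ..
qed

text \<open>Equal classes match at every precision \<open>n\<close>, never before stage
  \<open>n\<close>, which yields unboundedly many changes. Distinct classes are separated by a point
  that enters one of them at some stage \<open>m\<close>, and then no match has precision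
  \<open>m\<close> or more.\<close>

lemma finite_change_iff: "finite {t. change j t} \<longleftrightarrow> (\<forall>i<j. filtered_class i \<noteq> filtered_class j)"
proof
  assume fin: "finite {t. change j t}"
  show "\<forall>i<j. filtered_class i \<noteq> filtered_class j"
  proof (intro allI impI notI)
    fix i assume "i < j" "filtered_class i = filtered_class j"
    obtain m where m: "\<And>t. change j t \<Longrightarrow> t < m"
      using fin finite_nat_set_iff_bounded by auto
    define t where "t = (LEAST t. matching i j m t)"
    have "matching i j m t"
      unfolding t_def using ex_matching[OF \<open>filtered_class i = filtered_class j\<close>] by (rule LeastI_ex)
    moreover have "\<forall>u<t. \<not> matching i j m u"
      unfolding t_def using not_less_Least by blast
    ultimately have "first_match i j m t" "m \<le> t"
      by (simp_all add: first_match_def matching_def)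
    then have "change j t" using \<open>i < j\<close> unfolding change_def by blast
    with m \<open>m \<le> t\<close> show False using leD by blast
  qed
next
  assume neq: "\<forall>i<j. filtered_class i \<noteq> filtered_class j"
  have "finite {t. \<exists>n. first_match i j n t}" if "i < j" for i
  proof -
    have "\<exists>m. \<forall>n\<ge>m. \<forall>t. \<not> matching i j n t"
    proof -
      have "filtered_class i \<noteq> filtered_class j" using neq that by blast
      then obtain X where "X \<in> filtered_class i \<and> X \<notin> filtered_class j \<or> X \<in> filtered_class j \<and> X \<notin> filtered_class i" by blast
      then obtain m where "X \<in> filtered_stage i m \<and> X \<notin> filtered_class j \<or> X \<in> filtered_stage j m \<and> X \<notin> filtered_class i"
        unfolding filtered_class_def by blast
      then have "\<not> matching i j n t" if "m \<le> n" for n t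
        using filtered_stage_mono[OF that, of i] filtered_stage_mono[OF that, of j]
        unfolding matching_iff filtered_class_def by blast
      then show ?thesis by blast
    qed
    then obtain m where m: "\<And>n t. m \<le> n \<Longrightarrow> \<not> matching i j n t" by blast
    have "{t. \<exists>n. first_match i j n t} \<subseteq> (\<lambda>n. LEAST t. matching i j n t) ` {..<m}"
    proof
      fix t assume "t \<in> {t. \<exists>n. first_match i j n t}"
      then obtain n where n: "matching i j n t" "\<forall>u<t. \<not> matching i j n u"
        by (auto simp: first_match_def)
      then have "(LEAST t. matching i j n t) = t"
        by (intro Least_equality) (auto simp flip: not_less)
      moreover have "n < m" using m[of n t] n(1) by (meson not_less)
      ultimately show "t \<in> (\<lambda>n. LEAST t. matching i j n t) ` {..<m}" by force
    qed
    then show ?thesis by (rule finite_subset) simp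
  qed
  then have "finite (insert 0 (\<Union>i<j. {t. \<exists>n. first_match i j n t}))" by simp
  then show "finite {t. change j t}"
    by (rule rev_finite_subset) (auto simp: change_def)
qed

section \<open>Followers and their limits\<close>

definition next_change :: "nat \<Rightarrow> nat \<Rightarrow> nat \<Rightarrow> bool" where
  "next_change j s t \<longleftrightarrow> s < t \<and> change j t \<and> (\<forall>u<t. s < u \<longrightarrow> \<not> change j u)"

text \<open>Later also read as a longer string, padded with zeros. The cylinder of any length at
  least \<open>t\<close> around this word avoids everything enumerated up to stage \<open>t\<close>;
  \<open>filtered_word_not_full\<close> ensures that the minimum exists.\<close>

definition missed :: "nat \<Rightarrow> nat \<Rightarrow> nat" where
  "missed j t = (LEAST v. \<not> filtered_word j t (v mod 2 ^ t))"

definition used :: "nat \<Rightarrow> nat \<Rightarrow> bool" where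
  "used l v \<longleftrightarrow> change (pfst (pfst l)) (psnd (pfst l)) \<and>
     next_change (pfst (pfst l)) (psnd (pfst l)) (psnd l) \<and> v = missed (pfst (pfst l)) (psnd l)"

text \<open>
  An index is either \<open>\<langle>0, \<langle>j, s\<rangle>\<rangle>\<close>, the follower of \<open>j\<close> created at stage \<open>s\<close>, or \<open>\<langle>1, \<langle>l, v\<rangle>\<rangle>\<close>, a co-cylinder
  that no follower turns into. The length \<open>\<langle>\<langle>j, s\<rangle>, t\<rangle>\<close> of the string that a follower chooses at stage \<open>t\<close>
  determines the follower, so the choices are distinct and \<open>used\<close> is decidable.
\<close>

definition index :: "nat \<Rightarrow> bool" where
  "index e \<longleftrightarrow> pfst e = 0 \<and> change (pfst (psnd e)) (psnd (psnd e)) \<or>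
     pfst e = 1 \<and> 1 \<le> pfst (psnd e) \<and> psnd (psnd e) < 2 ^ pfst (psnd e) \<and>
       \<not> used (pfst (psnd e)) (psnd (psnd e))"

text \<open>\<open>r\<close> is both the stage and the length of the word. The co-cylinder is
  released only when \<open>r\<close> reaches the length \<open>pr (pr j s) t\<close> of its string,
  so that the word decides membership.\<close>

definition follower :: "nat \<Rightarrow> nat \<Rightarrow> nat \<Rightarrow> nat \<Rightarrow> bool" where
  "follower j s r w \<longleftrightarrow> (\<forall>t\<le>r. s < t \<longrightarrow> \<not> change j t) \<and> filtered_word j r w \<or>
     (\<exists>t\<le>r. next_change j s t \<and> pr (pr j s) t \<le> r \<and> \<not> w mod 2 ^ pr (pr j s) t = missed j t)"

definition stage :: "nat \<Rightarrow> nat \<Rightarrow> nat \<Rightarrow> bool" where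
  "stage e r w \<longleftrightarrow> pfst e = 0 \<and> follower (pfst (psnd e)) (psnd (psnd e)) r w \<or>
     \<not> pfst e = 0 \<and> pfst (psnd e) \<le> r \<and> \<not> w mod 2 ^ pfst (psnd e) = psnd (psnd e)"

definition limit :: "nat \<Rightarrow> cantor set" where
  "limit e = {X. \<exists>r. stage e r (word X r)}"

lemma missed_less: "missed j t < 2 ^ t" and not_filtered_word_missed: "\<not> filtered_word j t (missed j t mod 2 ^ t)"
proof -
  obtain w where w: "w < 2 ^ t" "\<not> filtered_word j t (w mod 2 ^ t)" using filtered_word_not_full[of t j] by auto
  have "missed j t \<le> w" unfolding missed_def using w(2) by (rule Least_le)
  with w(1) show "missed j t < 2 ^ t" by simp
  show "\<not> filtered_word j t (missed j t mod 2 ^ t)" unfolding missed_def using w(2) by (rule LeastI)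
qed

lemma decidable_next_change [comp_intros]:
  assumes "computable a" "computable b" "computable c"
  shows "decidable (\<lambda>x. next_change (a x) (b x) (c x))"
  by (rule decidable_app3[OF _ assms], unfold next_change_def) (intro comp_intros)

lemma computable_missed [comp_intros]:
  assumes "computable a" "computable b" shows "computable (\<lambda>x. missed (a x) (b x))"
  by (rule computable_app2[OF _ assms], unfold missed_def)
    (intro computable_Least comp_intros, metis filtered_word_not_full mod_less)

lemma decidable_used [comp_intros]:
  assumes "computable a" "computable b" shows "decidable (\<lambda>x. used (a x) (b x))"
  by (rule decidable_app2[OF _ assms], unfold used_def) (intro comp_intros)

lemma decidable_index: "decidable index"
  unfolding index_def[abs_def] by (intro comp_intros)

lemma decidable_follower [comp_intros]:
  assumes "computable a" "computable b" "computable c" "computable d"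
  shows "decidable (\<lambda>x. follower (a x) (b x) (c x) (d x))"
  by (rule decidable_app4[OF _ assms], unfold follower_def) (intro comp_intros)

lemma decidable_stage [comp_intros]:
  assumes "computable a" "computable b" "computable c"
  shows "decidable (\<lambda>x. stage (a x) (b x) (c x))"
  by (rule decidable_app3[OF _ assms], unfold stage_def) (intro comp_intros)

lemma next_change_unique: "next_change j s t \<Longrightarrow> next_change j s u \<Longrightarrow> t = u"
  unfolding next_change_def by (meson linorder_neqE_nat)

lemma limit_co_cylinder: "limit (pr 1 (pr l v)) = - cyl l v"
proof -
  have "(\<exists>r. l \<le> r \<and> word X r mod 2 ^ l \<noteq> v) \<longleftrightarrow> word X l \<noteq> v" for X
    using word_mod[of l _ X] by (metis order_refl)
  then show ?thesis by (simp add: limit_def stage_def cyl_def set_eq_iff)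
qed

lemma limit_live:
  assumes "\<forall>t>s. \<not> change j t" shows "limit (pr 0 (pr j s)) = filtered_class j"
proof -
  have "follower j s r w \<longleftrightarrow> filtered_word j r w" for r w
    using assms unfolding follower_def next_change_def by blast
  then show ?thesis by (auto simp: limit_def stage_def filtered_class_def filtered_stage_def)
qed

text \<open>Copying has stopped by stage \<open>t\<close>. The omitted cylinder has length at least
  \<open>t\<close> and its word is missed by stage \<open>t\<close>, so it is disjoint from the
  copied part, which the co-cylinder therefore absorbs.\<close>

lemma limit_dead:
  assumes t: "next_change j s t"
  shows "limit (pr 0 (pr j s)) = - cyl (pr (pr j s) t) (missed j t)"
proof -
  define l where "l = pr (pr j s) t"
  have "t \<le> l" unfolding l_def by (rule le_prod_encode_2)
  have "(\<exists>r. follower j s r (word X r)) \<longleftrightarrow> word X l \<noteq> missed j t" for X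
  proof
    assume "\<exists>r. follower j s r (word X r)"
    then consider r where "\<forall>t\<le>r. s < t \<longrightarrow> \<not> change j t" "filtered_word j r (word X r)"
      | r u where "next_change j s u" "pr (pr j s) u \<le> r" "word X r mod 2 ^ pr (pr j s) u \<noteq> missed j u"
      unfolding follower_def by blast
    then show "word X l \<noteq> missed j t"
    proof cases
      case 1
      then have "r \<le> t" using t unfolding next_change_def by (meson linear)
      then have "filtered_word j t (word X t)" using filtered_stage_mono[of r t j] 1(2) by (auto simp: filtered_stage_def)
      then show ?thesis using not_filtered_word_missed[of j t] word_mod[OF \<open>t \<le> l\<close>, of X] by metis
    next
      case 2
      have "u = t" using 2(1) t by (rule next_change_unique)
      then show ?thesis using 2(2,3) by (simp add: l_def word_mod)
    qed
  next
    assume "word X l \<noteq> missed j t"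
    then have "follower j s l (word X l)"
      unfolding follower_def using t \<open>t \<le> l\<close>
      by (intro disjI2 exI[of _ t]) (simp add: l_def word_mod)
    then show "\<exists>r. follower j s r (word X r)" ..
  qed
  then show ?thesis by (simp add: limit_def stage_def cyl_def set_eq_iff l_def)
qed

text \<open>The measure of a cylinder recovers its length; the word is then read off from the point
  \<open>bit v\<close>.\<close>

lemma cyl_inject:
  assumes "cyl n v = cyl m u" "v < 2 ^ n" "u < 2 ^ m" shows "n = m \<and> v = u"
proof -
  have "1 / 2 ^ n = (1 / 2 ^ m :: real)"
    using assms measure_cyl by metis
  then have "n = m" by simp
  moreover have "word (bit v) m = u"
    using word_bit[OF assms(2)] assms(1) by (auto simp: cyl_def)
  ultimately show ?thesis using word_bit[OF assms(2)] by simp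
qed

section \<open>The limits list every class exactly once\<close>

text \<open>A follower survives iff no change comes after its creation. In the case
  \<open>co_cylinder\<close>, \<open>e\<close> is written as a function of \<open>l\<close> and
  \<open>v\<close>, which is the form that injectivity needs.\<close>

lemma index_cases:
  assumes "index e"
  obtains (live) j s where "e = pr 0 (pr j s)" "change j s" "\<forall>t>s. \<not> change j t" "limit e = filtered_class j"
  | (co_cylinder) l v where "1 \<le> l" "v < 2 ^ l" "limit e = - cyl l v"
      "e = (if used l v then pr 0 (pfst l) else pr 1 (pr l v))"
proof (cases "pfst e = 0")
  case True
  define j s where "j = pfst (psnd e)" and "s = psnd (psnd e)"
  have e: "e = pr 0 (pr j s)" using True unfolding j_def s_def by (metis pr_collapse)
  have s: "change j s" using assms True by (simp add: index_def j_def s_def)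
  show ?thesis
  proof (cases "\<forall>t>s. \<not> change j t")
    case True
    then show ?thesis using live e s limit_live by blast
  next
    case False
    define t where "t = (LEAST t. s < t \<and> change j t)"
    have ex: "\<exists>t. s < t \<and> change j t" using False by blast
    have t: "next_change j s t"
      using LeastI_ex[OF ex] not_less_Least[of _ "\<lambda>t. s < t \<and> change j t"]
      unfolding next_change_def t_def by blast
    \<comment> \<open>The chosen length is at least \<open>t\<close>: it is positive because
      \<open>s < t\<close>, and large enough for \<open>missed j t\<close>.\<close>
    have "t \<le> pr (pr j s) t" by (rule le_prod_encode_2)
    moreover have "s < t" using t by (simp add: next_change_def)
    moreover have "missed j t < 2 ^ pr (pr j s) t"
      using missed_less[of j t] \<open>t \<le> pr (pr j s) t\<close>
      by (meson less_le_trans one_le_numeral power_increasing)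
    moreover have "used (pr (pr j s) t) (missed j t)" using s t by (simp add: used_def)
    ultimately show ?thesis
      by (intro co_cylinder[of "pr (pr j s) t" "missed j t"]) (simp_all add: e limit_dead[OF t])
  qed
next
  case False
  define l v where "l = pfst (psnd e)" and "v = psnd (psnd e)"
  have *: "pfst e = 1" "1 \<le> l" "v < 2 ^ l" "\<not> used l v"
    using assms False by (auto simp: index_def l_def v_def)
  have e: "e = pr 1 (pr l v)" using *(1) unfolding l_def v_def by (metis pr_collapse)
  show ?thesis
    using * limit_co_cylinder[of l v] by (intro co_cylinder[of l v]) (simp_all only: e if_False)
qed

text \<open>The two kinds of limits never meet by \<open>filtered_class_not_co_cylinder\<close>. A
  surviving follower belongs to the least index of its class and was created at the last change,
  hence is unique; a co-cylinder determines its string and so its index.\<close>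

lemma inj_on_limit: "inj_on limit {e. index e}"
proof (rule inj_onI)
  fix e e' assume "e \<in> {e. index e}" "e' \<in> {e. index e}" and eq: "limit e = limit e'"
  then have "index e" "index e'" by simp_all
  have no_mix: "limit e \<noteq> limit e'" if "limit e = filtered_class j" "limit e' = - cyl l v" "1 \<le> l" "v < 2 ^ l"
    for e e' j l v
    using that filtered_class_not_co_cylinder[of j] unfolding co_cylinders_def by auto
  have minimal: "\<forall>i<j. filtered_class i \<noteq> filtered_class j" if "\<forall>t>s. \<not> change j t" for j s
  proof -
    have "{t. change j t} \<subseteq> {..s}" using that not_less by blast
    then show ?thesis using finite_change_iff finite_subset by blast
  qed
  from \<open>index e\<close> show "e = e'"
  proof (cases rule: index_cases)
    case (live j s)
    note e = live
    from \<open>index e'\<close> show ?thesis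
    proof (cases rule: index_cases)
      case (live j' s')
      have "j = j'"
        using minimal[OF e(3)] minimal[OF live(3)] e(4) live(4) eq by (metis linorder_neqE_nat)
      moreover have "s = s'"
        using e(2,3) live(2,3) \<open>j = j'\<close> by (metis linorder_neqE_nat)
      ultimately show ?thesis using e(1) live(1) by simp
    next
      case (co_cylinder l v)
      with no_mix[OF e(4)] eq show ?thesis by blast
    qed
  next
    case (co_cylinder l v)
    note e = co_cylinder
    from \<open>index e'\<close> show ?thesis
    proof (cases rule: index_cases)
      case (live j s)
      with no_mix[OF live(4) e(3,1,2)] eq show ?thesis by simp
    next
      case (co_cylinder l' v')
      have "cyl l v = cyl l' v'" using e(3) co_cylinder(3) eq by simp
      then have "l = l' \<and> v = v'" using e(2) co_cylinder(2) by (rule cyl_inject)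
      then show ?thesis using e(4) co_cylinder(4) by simp
    qed
  qed
qed

lemma limit_image: "limit ` {e. index e} = co_cylinders \<union> range filtered_class"
proof
  show "limit ` {e. index e} \<subseteq> co_cylinders \<union> range filtered_class"
  proof (rule image_subsetI)
    fix e assume "e \<in> {e. index e}"
    then have "index e" by simp
    then show "limit e \<in> co_cylinders \<union> range filtered_class"
    proof (cases rule: index_cases)
      case (co_cylinder l v)
      from co_cylinder(1,2) show ?thesis unfolding co_cylinder(3) co_cylinders_def by blast
    next
      case (live j s)
      then show ?thesis by simp
    qed
  qed
  have "- cyl l v \<in> limit ` {e. index e}" if "1 \<le> l" "v < 2 ^ l" for l v
  proof (cases "used l v")
    case True
    define j s t where "j = pfst (pfst l)" and "s = psnd (pfst l)" and "t = psnd l"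
    have l: "l = pr (pr j s) t" unfolding j_def s_def t_def by simp
    have *: "change j s" "next_change j s t" "v = missed j t"
      using True unfolding used_def j_def s_def t_def by blast+
    show ?thesis
    proof (rule image_eqI)
      show "- cyl l v = limit (pr 0 (pr j s))" unfolding limit_dead[OF *(2)] l *(3) ..
      show "pr 0 (pr j s) \<in> {e. index e}" using *(1) by (simp add: index_def)
    qed
  next
    case False
    then have "pr 1 (pr l v) \<in> {e. index e}" using that by (simp add: index_def)
    then show ?thesis unfolding limit_co_cylinder[symmetric] by (rule imageI)
  qed
  moreover have "filtered_class j \<in> limit ` {e. index e}" for j
  proof -
    \<comment> \<open>The least index of the class has finitely many changes, and the follower
      created at the last one survives. A last change exists because stage \<open>0\<close> is
      one.\<close>
    define i where "i = (LEAST i. filtered_class i = filtered_class j)"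
    have i: "filtered_class i = filtered_class j" unfolding i_def by (rule LeastI[of _ j]) simp
    have "\<forall>k<i. filtered_class k \<noteq> filtered_class j"
      unfolding i_def using not_less_Least[of _ "\<lambda>i. filtered_class i = filtered_class j"] by blast
    then have fin: "finite {t. change i t}" unfolding finite_change_iff i .
    define s where "s = Max {t. change i t}"
    have "change i 0" by (simp add: change_def)
    then have "s \<in> {t. change i t}" unfolding s_def using fin by (intro Max_in) auto
    then have "pr 0 (pr i s) \<in> {e. index e}" by (simp add: index_def)
    moreover have "\<forall>t>s. \<not> change i t"
    proof (intro allI impI notI)
      fix t assume "s < t" "change i t"
      then have "t \<le> s" unfolding s_def using fin by (intro Max_ge) simp_all
      with \<open>s < t\<close> show False by simp
    qed
    then have "filtered_class j = limit (pr 0 (pr i s))" using limit_live i by simp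
    ultimately show ?thesis by (intro image_eqI)
  qed
  ultimately show "co_cylinders \<union> range filtered_class \<subseteq> limit ` {e. index e}"
    unfolding co_cylinders_def by (intro Un_least image_subsetI subsetI) auto
qed

section \<open>From the limits to the two numberings\<close>

lemma Sigma01_classes_eq:
  "{U. Sigma01_class U \<and> measure coin_measure U < 1} = co_cylinders \<union> range filtered_class"
proof
  show "{U. Sigma01_class U \<and> measure coin_measure U < 1} \<subseteq> co_cylinders \<union> range filtered_class"
    using Sigma01_class_cases by blast
  have "Sigma01_class (filtered_class j)" for j
  proof -
    have "Sigma01_class {X. \<exists>n. filtered_word j n (word X n)}"
      by (intro Sigma01_class_words comp_intros)
    moreover have "{X. \<exists>n. filtered_word j n (word X n)} = filtered_class j" by (auto simp: filtered_class_def filtered_stage_def)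
    ultimately show ?thesis by simp
  qed
  moreover have "Sigma01_class (- cyl l v)" for l v
  proof -
    have "Sigma01_class {X. \<exists>n. stage (pr 1 (pr l v)) n (word X n)}"
      by (intro Sigma01_class_words comp_intros)
    then show ?thesis unfolding limit_def[symmetric] limit_co_cylinder .
  qed
  moreover have "measure coin_measure (- cyl l v) < 1" if "v < 2 ^ l" for l v
    using measure_Compl_cyl[OF that] by simp
  ultimately show "co_cylinders \<union> range filtered_class \<subseteq> {U. Sigma01_class U \<and> measure coin_measure U < 1}"
    using measure_filtered_class unfolding co_cylinders_def by blast
qed

lemma sets_Sigma01_class: "Sigma01_class U \<Longrightarrow> U \<in> sets coin_measure"
proof -
  assume "Sigma01_class U"
  then obtain c where "U = {X. \<exists>s. sigma_word c s (word X s)}" by (rule Sigma01_class_sigma_word)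
  then have "U = (\<Union>s. sigma_stage c s)" by (auto simp: sigma_stage_def)
  then show ?thesis by auto
qed

theorem corollary24:
  "(\<exists>\<psi>. Sigma01_Friedberg_numbering \<psi> {U. Sigma01_class U \<and> measure coin_measure U < 1})
   \<and> (\<exists>\<psi>. Pi01_Friedberg_numbering \<psi> {P. Pi01_class P \<and> measure coin_measure P > 0})"
proof -
  define F where "F = {U. Sigma01_class U \<and> measure coin_measure U < 1}"
  define I where "I = {e. index e}"
  define \<psi> where "\<psi> = limit \<circ> enumerate I"
  \<comment> \<open>Every \<open>j\<close> has a follower created at stage \<open>0\<close>, so
    there are infinitely many indices and \<open>enumerate I\<close> renumbers them by all natural
    numbers.\<close>
  have "inj (\<lambda>j. pr 0 (pr j 0))" by (auto simp: inj_def prod_encode_eq)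
  then have "infinite (range (\<lambda>j. pr 0 (pr j 0)))" by (simp add: finite_image_iff)
  moreover have "range (\<lambda>j. pr 0 (pr j 0)) \<subseteq> I" by (auto simp: I_def index_def change_def)
  ultimately have inf: "infinite I" using finite_subset by blast
  have enum: "computable (enumerate I)"
    by (rule computable_enumerate[OF _ inf]) (simp add: I_def decidable_index)
  have "range \<psi> = limit ` range (enumerate I)" by (simp add: \<psi>_def image_comp)
  also have "\<dots> = F"
    unfolding range_enumerate[OF inf] unfolding I_def limit_image F_def Sigma01_classes_eq ..
  finally have range: "range \<psi> = F" .
  have "inj_on limit (range (enumerate I))"
    unfolding range_enumerate[OF inf] unfolding I_def by (rule inj_on_limit)
  then have inj: "inj \<psi>"
    unfolding \<psi>_def by (rule comp_inj_on[OF strict_mono_imp_inj_on[OF strict_mono_enumerate[OF inf]]])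
  have mem: "X \<in> \<psi> e \<longleftrightarrow> (\<exists>r. stage (enumerate I e) r (word X r))" for X e
    by (simp add: \<psi>_def limit_def)
  have "Sigma01_rel {(X, e). X \<in> \<psi> e}"
    unfolding mem by (intro Sigma01_rel_words comp_intros computable_app1[OF enum])
  with range inj have Sigma: "Sigma01_Friedberg_numbering \<psi> F"
    by (simp add: Sigma01_Friedberg_numbering_def Sigma01_numbering_def)
  have "Pi01_rel {(X, e). \<forall>r. \<not> stage (enumerate I e) r (word X r)}"
    by (intro Pi01_rel_words comp_intros computable_app1[OF enum])
  then have "Pi01_rel {(X, e). X \<in> - \<psi> e}" by (simp add: mem)
  moreover have "inj (\<lambda>e. - \<psi> e)" using inj by (simp add: inj_def)
  moreover have "range (\<lambda>e. - \<psi> e) = {P. Pi01_class P \<and> measure coin_measure P > 0}"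
  proof -
    have "measure coin_measure (- U) > 0 \<longleftrightarrow> measure coin_measure U < 1" if "Sigma01_class U" for U
      using coin.prob_compl[OF sets_Sigma01_class[OF that]] by (simp add: Compl_eq_Diff_UNIV)
    then have "- U \<in> {P. Pi01_class P \<and> measure coin_measure P > 0} \<longleftrightarrow> U \<in> F" for U
      unfolding F_def Sigma01_class_def by blast
    then have "P \<in> {P. Pi01_class P \<and> measure coin_measure P > 0} \<longleftrightarrow> - P \<in> F" for P
      by (metis double_complement)
    moreover have "P \<in> uminus ` F \<longleftrightarrow> - P \<in> F" for P
      using imageI[of "- P" F uminus] by auto
    ultimately have "{P. Pi01_class P \<and> measure coin_measure P > 0} = uminus ` F" by blast
    also have "\<dots> = range (\<lambda>e. - \<psi> e)" unfolding range[symmetric] by (simp add: image_image)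
    finally show ?thesis ..
  qed
  ultimately have "Pi01_Friedberg_numbering (\<lambda>e. - \<psi> e) {P. Pi01_class P \<and> measure coin_measure P > 0}"
    by (simp add: Pi01_Friedberg_numbering_def Pi01_numbering_def)
  with Sigma show ?thesis unfolding F_def by blast
qed

end
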